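(* Let $\Gamma$ be a ribbon graph of an abstract graph $G(V,E)$ (not necessarily trivalent or planar) in which one of the configurations described below appears, and suppose the edges emanating from the configuration are distinct in $\Gamma$. Let $\Gamma'$ be the ribbon graph obtained by the indicated replacement. Then the Penrose polynomials satisfy, for all $n$: 1. If the configuration is a degree-2 vertex with emanating edges $s_1,s_2$, and $\Gamma'$ is obtained by deleting the vertex and joining $s_1,s_2$ into a single edge, then $[\Gamma]_n=2[\Gamma']_n$. 2. If the configuration is a 4-valent vertex with cyclic order of half-edges $(s_1,s_2,\ell,\ell')$, where $\ell,\ell'$ are the two ends of one untwisted loop and $s_1,s_2$ are the emanating edges, and $\Gamma'$ is obtained by deleting the vertex and the loop and joining $s_1,s_2$ into a single edge, then $[\Gamma]_n=2(n-1)[\Gamma']_n$. 3. If the configuration is a bubble, i.e. two trivalent vertices joined by two untwisted parallel edges bounding a 2-gon face, with emanating edges $s_1,s_2$, and $\Gamma'$ is obtained by deleting the bubble and joining $s_1,s_2$ into a single edge, then $[\Gamma]_n=2(n-2)[\Gamma']_n$. 4. If the configuration is a trivalent vertex with emanating edges $s_1,s_2,s_3$ in which two of the edges are crossed by a virtual crossing, i.e. the clockwise order at the vertex is $(s_1,s_3,s_2)$, and $\Gamma'$ is obtained by replacing it with an uncrossed trivalent vertex, i.e. changing the clockwise order at the vertex to $(s_1,s_2,s_3)$ with everything else (including twists of edges) unchanged, then $[\Gamma]_n=-[\Gamma']_n$. 5. If the configuration is a triangular face with emanating edges $s_1,s_2,s_3$ in clockwise order, and $\Gamma'$ is obtained by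 replacing the triangle with a single trivalent vertex of clockwise order $(s_1,s_2,s_3)$, then $[\Gamma]_n=(n-2)[\Gamma']_n$.
   Context: Ribbon graphs. A ribbon graph $\Gamma$ of a finite graph $G(V,E)$ (loops and multiple edges allowed) is a compact surface with boundary made of a disc for each vertex and a ribbon (band) for each edge, attached to the vertex discs; capping its boundary circles (faces) with discs gives a closed surface. It is presented by a cyclic order of half-edges at each vertex together with a label "untwisted" or "half-twisted" on each edge. In plane diagrams, edges may cross each other in virtual crossings, which carry no information. Penrose polynomial. For a trivalent graph with a perfect matching $M$, the bracket $[\Gamma_M]_n$ of the perfect matching graph $\Gamma_M$ is computed by replacing each matching edge by the difference (0-smoothing) $-$ (1-smoothing): the 0-smoothing deletes the edge and joins the four remaining strands along the two sides of its ribbon; the 1-smoothing joins them along the two sides of the ribbon after inserting an extra half-twist (so the two strands cross). A closed circle has value $n$ (multiplicatively). For an arbitrary ribbon graph $\Gamma$, the blowup $\Gamma_E^\flat$ replaces each vertex of degree $d$ by a $d$-cycle (the boundary of the vertex disc), with canonical perfect matching the original edge set $E$, and $[\Gamma]_n:=[\Gamma_E^\flat]_n$. Explicitly, $[\Gamma]_n=\sum_{A\subseteq E}(-1)^{|A|}n^{b(A)}$, where $b(A)$ is the number of boundary circles of the ribbon surface obtained from $\Gamma$ by inserting an extra half-twist in the ribbon of each edge of $A$. Polygonal faces. A $k$-gonal face ($k=2,3$) with emanating edges $s_1,\dots,s_k$ in clockwise order means: trivalent vertices $v_1,\dots,v_k$ (indices mod $k$), untwisted edges $c_i$ from $v_i$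 to $v_{i+1}$, and emanating edges $s_i$ at $v_i$, with clockwise order $(s_i,c_i,c_{i-1})$ at $v_i$, so that $c_1\cdots c_k$ bounds a face disc. Each replacement takes place inside a disc containing the configuration. When two emanating edges are joined into a single edge, its half-twist is the sum modulo 2 of the half-twists of the two edges. *)

theory Defs
  imports Complex_Main "HOL-Combinatorics.Orbits"
begin

(* A ribbon graph, presented by half-edges: mate pairs the two halves of an edge,
   rot sends a half-edge to the next one in clockwise order at its vertex, and
   twisted is the set of half-twisted edges.  Vertices are listed explicitly, so
   isolated vertices (discs without ribbons) are possible. *)
record ('v, 'h) rgraph =
  verts :: "'v set"
  halves :: "'h set"
  vert :: "'h \<Rightarrow> 'v"
  mate :: "'h \<Rightarrow> 'h"
  rot :: "'h \<Rightarrow> 'h"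
  twisted :: "'h set set"

definition halves_at :: "('v, 'h) rgraph \<Rightarrow> 'v \<Rightarrow> 'h set" where
  "halves_at \<Gamma> v = {h \<in> halves \<Gamma>. vert \<Gamma> h = v}"

definition edge_of :: "('v, 'h) rgraph \<Rightarrow> 'h \<Rightarrow> 'h set" where
  "edge_of \<Gamma> h = {h, mate \<Gamma> h}"

definition edges :: "('v, 'h) rgraph \<Rightarrow> 'h set set" where
  "edges \<Gamma> = edge_of \<Gamma> ` halves \<Gamma>"

definition ribbon_graph :: "('v, 'h) rgraph \<Rightarrow> bool" where
  "ribbon_graph \<Gamma> \<longleftrightarrow>
     finite (verts \<Gamma>) \<and> finite (halves \<Gamma>) \<and>
     vert \<Gamma> ` halves \<Gamma> \<subseteq> verts \<Gamma> \<and>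
     (\<forall>h\<in>halves \<Gamma>. mate \<Gamma> h \<in> halves \<Gamma> \<and> mate \<Gamma> h \<noteq> h \<and> mate \<Gamma> (mate \<Gamma> h) = h) \<and>
     (\<forall>v\<in>verts \<Gamma>. halves_at \<Gamma> v \<noteq> {} \<longrightarrow> cyclic_on (rot \<Gamma>) (halves_at \<Gamma> v)) \<and>
     twisted \<Gamma> \<subseteq> edges \<Gamma>"

(* The attaching segment of a half-edge h on its vertex disc has two end points:
   (h, True) on the clockwise side of h and (h, False) on the counterclockwise side.
   The boundary of the ribbon surface is made of the arcs of the vertex discs between
   consecutive half-edges and of the two sides of each ribbon.  Seen from the vertex,
   the clockwise side of h continues along an untwisted ribbon to the counterclockwise
   side of the opposite half-edge; a half-twist exchanges the two sides. *)
definition boundary_arcs :: "('v, 'h) rgraph \<Rightarrow> (('h \<times> bool) \<times> ('h \<times> bool)) set" where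
  "boundary_arcs \<Gamma> =
     {((h, True), (rot \<Gamma> h, False)) | h. h \<in> halves \<Gamma>} \<union>
     {((h, x), (mate \<Gamma> h, y)) | h x y. h \<in> halves \<Gamma> \<and> (x = y \<longleftrightarrow> edge_of \<Gamma> h \<in> twisted \<Gamma>)}"

(* Boundary circles are the connected components formed by these arcs, together with
   the whole boundary of the disc of each isolated vertex. *)
definition boundary_circles :: "('v, 'h) rgraph \<Rightarrow> nat" where
  "boundary_circles \<Gamma> =
     card ((halves \<Gamma> \<times> UNIV) // (boundary_arcs \<Gamma> \<union> (boundary_arcs \<Gamma>)\<inverse>)\<^sup>*) +
     card {v \<in> verts \<Gamma>. halves_at \<Gamma> v = {}}"

definition add_twists :: "'h set set \<Rightarrow> ('v, 'h) rgraph \<Rightarrow> ('v, 'h) rgraph" where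
  "add_twists A \<Gamma> = \<Gamma>\<lparr>twisted := (twisted \<Gamma> - A) \<union> (A - twisted \<Gamma>)\<rparr>"

(* The Penrose polynomial of the ribbon graph, evaluated at an element n of an arbitrary
   commutative ring; n = [:0, 1:] :: int poly gives the polynomial itself. *)
definition penrose :: "('v, 'h) rgraph \<Rightarrow> 'a::comm_ring_1 \<Rightarrow> 'a" where
  "penrose \<Gamma> n =
     (\<Sum>A\<in>Pow (edges \<Gamma>). (-1) ^ card A * n ^ boundary_circles (add_twists A \<Gamma>))"

(* v is a vertex of degree length hs, with clockwise cyclic order of half-edges hs *)
definition clockwise_at :: "('v, 'h) rgraph \<Rightarrow> 'v \<Rightarrow> 'h list \<Rightarrow> bool" where
  "clockwise_at \<Gamma> v hs \<longleftrightarrow>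
     v \<in> verts \<Gamma> \<and> distinct hs \<and> set hs = halves_at \<Gamma> v \<and>
     (\<forall>i<length hs. rot \<Gamma> (hs ! i) = hs ! (Suc i mod length hs))"

(* Vertices v i (i < k), with half-edge s i of the emanating edge at v i; the edge c_i of the
   face runs from v i to v (i + 1 mod k), its half at v i being a i and its half at
   v (i + 1 mod k) being b (i + 1 mod k).  So the clockwise order (s_i, c_i, c_{i-1}) at v i
   reads s i, a i, b i. *)
definition polygonal_face ::
  "('v, 'h) rgraph \<Rightarrow> nat \<Rightarrow> (nat \<Rightarrow> 'v) \<Rightarrow> (nat \<Rightarrow> 'h) \<Rightarrow> (nat \<Rightarrow> 'h) \<Rightarrow> (nat \<Rightarrow> 'h) \<Rightarrow> bool" where
  "polygonal_face \<Gamma> k v s a b \<longleftrightarrow>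
     inj_on v {..<k} \<and>
     (\<forall>i<k. clockwise_at \<Gamma> (v i) [s i, a i, b i] \<and>
            mate \<Gamma> (a i) = b (Suc i mod k) \<and>
            edge_of \<Gamma> (a i) \<notin> twisted \<Gamma>)"

(* Delete the vertices W with all half-edges at them, and join the two edges emanating
   from W through the half-edges h1, h2 into a single edge; half-twists add modulo 2. *)
definition delete_and_join :: "('v, 'h) rgraph \<Rightarrow> 'v set \<Rightarrow> 'h \<Rightarrow> 'h \<Rightarrow> ('v, 'h) rgraph" where
  "delete_and_join \<Gamma> W h1 h2 =
     (let H = {h \<in> halves \<Gamma>. vert \<Gamma> h \<notin> W}; g1 = mate \<Gamma> h1; g2 = mate \<Gamma> h2 in
      \<Gamma>\<lparr>verts := verts \<Gamma> - W,
        halves := H,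
        mate := (mate \<Gamma>)(g1 := g2, g2 := g1),
        twisted := {e \<in> twisted \<Gamma>. e \<subseteq> H} \<union>
          (if (edge_of \<Gamma> h1 \<in> twisted \<Gamma>) \<noteq> (edge_of \<Gamma> h2 \<in> twisted \<Gamma>) then {{g1, g2}} else {})\<rparr>)"

definition reorder3 :: "('v, 'h) rgraph \<Rightarrow> 'h \<Rightarrow> 'h \<Rightarrow> 'h \<Rightarrow> ('v, 'h) rgraph" where
  "reorder3 \<Gamma> h1 h2 h3 = \<Gamma>\<lparr>rot := (rot \<Gamma>)(h1 := h2, h2 := h3, h3 := h1)\<rparr>"

(* Replace a triangular face with emanating half-edges s 0, s 1, s 2 by one trivalent vertex,
   for which the name v 0 is reused.  The deleted edges are untwisted, so twisted is unchanged. *)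
definition contract_triangle ::
  "('v, 'h) rgraph \<Rightarrow> (nat \<Rightarrow> 'v) \<Rightarrow> (nat \<Rightarrow> 'h) \<Rightarrow> ('v, 'h) rgraph" where
  "contract_triangle \<Gamma> v s =
     reorder3
       (\<Gamma>\<lparr>verts := verts \<Gamma> - {v 1, v 2},
          halves := {h \<in> halves \<Gamma>. vert \<Gamma> h \<notin> {v 0, v 1, v 2}} \<union> {s 0, s 1, s 2},
          vert := (vert \<Gamma>)(s 0 := v 0, s 1 := v 0, s 2 := v 0)\<rparr>)
       (s 0) (s 1) (s 2)"

end

theory Submission
  imports Defs
begin

text \<open>Two points of the surface boundary lie on the same circle iff every labelling of the
  half-edge sides by truth values that is constant along the boundary arcs takes the same value at
  both. A local replacement that transports labellings back and forth therefore preserves the number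
  of circles, and one that leaves over an unconstrained side has split off one circle.

  Expanding the signed sum over the edges inside the configuration leaves a sum over subsets of the
  remaining edges for each choice of inner twists. For the triangle, the untwisted term splits off
  the face circle and contributes \<open>n\<close>; each single twist merges the face circle into a strand and
  contributes \<open>-1\<close>; in the terms with two twists a strand turns back to its own emanating ribbon, so
  twisting that ribbon cancels the sum; three twists reverse the cyclic order, and reversing the
  order at a trivalent vertex amounts to twisting all three ribbons, so together with the
  sign of the term this contributes \<open>+1\<close>. Loops and bubbles reduce in the same way to a
  degree-2 vertex, where only the sum of the two half-twists matters.\<close>

section \<open>Boundary circles through labellings\<close>

text \<open>The side \<open>x = (edge_of \<Gamma> h \<in> twisted \<Gamma>)\<close> is
  \<open>x\<close> on a half-twisted ribbon and \<open>\<not> x\<close> on an untwisted one, as in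
  \<open>boundary_arcs\<close>.\<close>

definition labelling :: "('v, 'h) rgraph \<Rightarrow> ('h \<times> bool \<Rightarrow> bool) \<Rightarrow> bool" where
  "labelling \<Gamma> g \<longleftrightarrow>
     (\<forall>h\<in>halves \<Gamma>. g (h, True) = g (rot \<Gamma> h, False) \<and>
        (\<forall>x. g (h, x) = g (mate \<Gamma> h, x = (edge_of \<Gamma> h \<in> twisted \<Gamma>))))"

text \<open>The class ranges over all points and not only over those being counted, so it does not
  change when points are added to the set \<open>X\<close> of \<open>num_classes\<close>.\<close>

definition inseparable :: "(('p \<Rightarrow> bool) \<Rightarrow> bool) \<Rightarrow> 'p \<Rightarrow> 'p set" where
  "inseparable L x = {y. \<forall>g. L g \<longrightarrow> g x = g y}"

definition num_classes :: "'p set \<Rightarrow> (('p \<Rightarrow> bool) \<Rightarrow> bool) \<Rightarrow> nat" where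
  "num_classes X L = card (inseparable L ` X)"

lemma inseparable_eq_iff:
  "inseparable L x = inseparable L y \<longleftrightarrow> (\<forall>g. L g \<longrightarrow> g x = g y)"
  unfolding inseparable_def by blast

text \<open>The indicator function of the component of \<open>x\<close> is constant along
  \<open>R\<close>, so it separates \<open>x\<close> from every point that is not reachable.\<close>

lemma rtrancl_symcl_iff:
  "(x, y) \<in> (R \<union> R\<inverse>)\<^sup>* \<longleftrightarrow> (\<forall>g :: 'p \<Rightarrow> bool. (\<forall>(u, v)\<in>R. g u = g v) \<longrightarrow> g x = g y)"
proof
  assume "(x, y) \<in> (R \<union> R\<inverse>)\<^sup>*"
  then show "\<forall>g :: 'p \<Rightarrow> bool. (\<forall>(u, v)\<in>R. g u = g v) \<longrightarrow> g x = g y"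
    by induction auto
next
  assume *: "\<forall>g :: 'p \<Rightarrow> bool. (\<forall>(u, v)\<in>R. g u = g v) \<longrightarrow> g x = g y"
  let ?g = "\<lambda>u. (x, u) \<in> (R \<union> R\<inverse>)\<^sup>*"
  have "?g u = ?g v" if "(u, v) \<in> R" for u v
  proof -
    have "(u, v) \<in> R \<union> R\<inverse>" "(v, u) \<in> R \<union> R\<inverse>" using that by auto
    then show ?thesis by (meson rtrancl.rtrancl_into_rtrancl)
  qed
  then have "\<forall>(u, v)\<in>R. ?g u = ?g v" by blast
  with spec[OF *, of ?g] have "?g x = ?g y" by (rule mp)
  then show "(x, y) \<in> (R \<union> R\<inverse>)\<^sup>*" by simp
qed

lemma labelling_iff_boundary_arcs:
  "labelling \<Gamma> g \<longleftrightarrow> (\<forall>(u, v)\<in>boundary_arcs \<Gamma>. g u = g v)"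
proof
  assume "\<forall>(u, v)\<in>boundary_arcs \<Gamma>. g u = g v"
  then have *: "g u = g v" if "(u, v) \<in> boundary_arcs \<Gamma>" for u v
    using that by blast
  show "labelling \<Gamma> g"
    unfolding labelling_def
  proof (intro ballI conjI allI)
    fix h x assume "h \<in> halves \<Gamma>"
    then show "g (h, True) = g (rot \<Gamma> h, False)"
      "g (h, x) = g (mate \<Gamma> h, x = (edge_of \<Gamma> h \<in> twisted \<Gamma>))"
      by (intro *; force simp: boundary_arcs_def)+
  qed
next
  assume lab: "labelling \<Gamma> g"
  have "g u = g v" if "(u, v) \<in> boundary_arcs \<Gamma>" for u v
    using that unfolding boundary_arcs_def
  proof (elim UnE CollectE exE conjE)
    fix h assume "(u, v) = ((h, True), (rot \<Gamma> h, False))" "h \<in> halves \<Gamma>"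
    then show ?thesis using lab unfolding labelling_def by blast
  next
    fix h x y
    assume uv: "(u, v) = ((h, x), (mate \<Gamma> h, y))" and h: "h \<in> halves \<Gamma>"
      and "(x = y) = (edge_of \<Gamma> h \<in> twisted \<Gamma>)"
    then have "y = (x = (edge_of \<Gamma> h \<in> twisted \<Gamma>))" by blast
    then show ?thesis using lab uv h unfolding labelling_def by blast
  qed
  then show "\<forall>(u, v)\<in>boundary_arcs \<Gamma>. g u = g v" by blast
qed

lemma boundary_circles_eq_num_classes:
  "boundary_circles \<Gamma> =
     num_classes (halves \<Gamma> \<times> UNIV) (labelling \<Gamma>) + card {v \<in> verts \<Gamma>. halves_at \<Gamma> v = {}}"
proof -
  have "(boundary_arcs \<Gamma> \<union> (boundary_arcs \<Gamma>)\<inverse>)\<^sup>* `` {x} = inseparable (labelling \<Gamma>) x" for x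
    unfolding inseparable_def labelling_iff_boundary_arcs
    by (rule set_eqI) (simp only: Image_singleton_iff mem_Collect_eq rtrancl_symcl_iff)
  then show ?thesis
    by (simp add: boundary_circles_def num_classes_def quotient_def UNION_singleton_eq_range)
qed

text \<open>Labellings are pulled back along \<open>f\<close> in one direction and along
  \<open>h\<close> in the other, and \<open>h\<close> undoes \<open>f\<close> as far as labellings
  can see. So \<open>f\<close> need not be injective: it may collapse points of the same
  class.\<close>

lemma num_classes_eqI:
  assumes "f ` X = Y"
    and "\<And>g. L' g \<Longrightarrow> L (g \<circ> f)"
    and "\<And>g. L g \<Longrightarrow> L' (g \<circ> h)"
    and "\<And>g x. L g \<Longrightarrow> x \<in> X \<Longrightarrow> g (h (f x)) = g x"
  shows "num_classes X L = num_classes Y L'"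
proof -
  have iff: "inseparable L x = inseparable L y \<longleftrightarrow> inseparable L' (f x) = inseparable L' (f y)"
    if "x \<in> X" "y \<in> X" for x y
    unfolding inseparable_eq_iff
  proof
    assume *: "\<forall>g. L g \<longrightarrow> g x = g y"
    show "\<forall>g. L' g \<longrightarrow> g (f x) = g (f y)"
    proof (rule allI, rule impI)
      fix g assume "L' g"
      then have "L (g \<circ> f)" by (rule assms(2))
      then show "g (f x) = g (f y)" using spec[OF *, of "g \<circ> f"] unfolding o_apply by (rule rev_mp)
    qed
  next
    assume *: "\<forall>g. L' g \<longrightarrow> g (f x) = g (f y)"
    show "\<forall>g. L g \<longrightarrow> g x = g y"
    proof (rule allI, rule impI)
      fix g assume g: "L g"
      then have "L' (g \<circ> h)" by (rule assms(3))
      then have "g (h (f x)) = g (h (f y))"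
        using spec[OF *, of "g \<circ> h"] unfolding o_apply by (rule rev_mp)
      then show "g x = g y" unfolding assms(4)[OF g that(1)] assms(4)[OF g that(2)] .
    qed
  qed
  \<comment> \<open>The class of \<open>x\<close> goes to the class of \<open>f x\<close>, computed
    from a chosen representative; \<open>iff\<close> makes this independent of the choice and
    injective.\<close>
  let ?k = "\<lambda>c. inseparable L' (f (inv_into X (inseparable L) c))"
  have k: "?k (inseparable L x) = inseparable L' (f x)" if "x \<in> X" for x
    using that iff[of "inv_into X (inseparable L) (inseparable L x)" x]
    by (simp add: inv_into_into f_inv_into_f)
  have "bij_betw ?k (inseparable L ` X) (inseparable L' ` f ` X)"
    by (rule bij_betw_imageI) (auto simp: inj_on_def k iff image_image cong: image_cong)
  then show ?thesis
    unfolding num_classes_def assms(1)[symmetric] by (rule bij_betw_same_card)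
qed

text \<open>The value at \<open>p\<close> can be overwritten to differ from the value at any given
  point of \<open>X\<close>, so \<open>p\<close> is a class of its own.\<close>

lemma num_classes_insert_free:
  assumes "finite X" "p \<notin> X" and "L g" and "\<And>g c. L g \<Longrightarrow> L (g(p := c))"
  shows "num_classes (insert p X) L = Suc (num_classes X L)"
proof -
  have "inseparable L p \<noteq> inseparable L x" if "x \<in> X" for x
  proof -
    have "(g(p := \<not> g x)) p \<noteq> (g(p := \<not> g x)) x" using that assms(2) by auto
    then show ?thesis using assms(3,4) unfolding inseparable_eq_iff by blast
  qed
  then show ?thesis
    unfolding num_classes_def using assms(1) by (auto simp: card_insert_if image_iff)
qed

section \<open>Signed sums over subsets\<close>

definition signed_sum :: "'e set \<Rightarrow> ('e set \<Rightarrow> 'a::comm_ring_1) \<Rightarrow> 'a" where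
  "signed_sum E f = (\<Sum>A\<in>Pow E. (-1) ^ card A * f A)"

lemma penrose_eq_signed_sum:
  "penrose \<Gamma> n = signed_sum (edges \<Gamma>) (\<lambda>A. n ^ boundary_circles (add_twists A \<Gamma>))"
  by (simp add: penrose_def signed_sum_def)

lemma signed_sum_cong:
  "E = E' \<Longrightarrow> (\<And>A. A \<subseteq> E' \<Longrightarrow> f A = g A) \<Longrightarrow> signed_sum E f = signed_sum E' g"
  by (simp add: signed_sum_def)

text \<open>The subsets containing \<open>e\<close> have one more element, which accounts for the
  minus sign.\<close>

lemma signed_sum_insert:
  assumes "finite E" "e \<notin> E"
  shows "signed_sum (insert e E) f = signed_sum E f - signed_sum E (\<lambda>A. f (insert e A))"
proof -
  have inj: "inj_on (insert e) (Pow E)"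
    using assms(2) by (auto simp: inj_on_def)
  have "signed_sum (insert e E) f
      = signed_sum E f + (\<Sum>A\<in>insert e ` Pow E. (-1) ^ card A * f A)"
    unfolding signed_sum_def Pow_insert using assms
    by (subst sum.union_disjoint) auto
  also have "(\<Sum>A\<in>insert e ` Pow E. (-1) ^ card A * f A)
      = (\<Sum>A\<in>Pow E. - ((-1) ^ card A * f (insert e A)))"
    unfolding sum.reindex[OF inj]
  proof (rule sum.cong, goal_cases)
    case (2 A)
    then have "finite A" "e \<notin> A" using assms by (auto intro: finite_subset)
    then show ?case by simp
  qed simp
  finally show ?thesis by (simp add: signed_sum_def sum_negf)
qed

lemma signed_sum_mult: "signed_sum E (\<lambda>A. c * f A) = c * signed_sum E f"
  by (simp add: signed_sum_def sum_distrib_left algebra_simps)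

section \<open>Toggling one element in a signed sum\<close>

definition toggle :: "'e \<Rightarrow> 'e set \<Rightarrow> 'e set" where
  "toggle e A = (if e \<in> A then A - {e} else insert e A)"

lemma mem_toggle_iff: "x \<in> toggle e A \<longleftrightarrow> (x \<in> A) \<noteq> (x = e)"
  by (auto simp: toggle_def)

lemma mem_toggle3_iff:
  "distinct [a, b, c] \<Longrightarrow>
    x \<in> toggle a (toggle b (toggle c A)) \<longleftrightarrow> (x \<in> A) \<noteq> (x = a \<or> x = b \<or> x = c)"
  by (auto simp: mem_toggle_iff)

text \<open>Toggling exchanges the subsets with and without \<open>e\<close> and changes the parity
  of the cardinality, hence the sign.\<close>

lemma signed_sum_toggle:
  assumes "finite E" "e \<in> E"
  shows "signed_sum E (\<lambda>A. f (toggle e A)) = - signed_sum E f"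
proof -
  obtain E0 where E: "E = insert e E0" "e \<notin> E0" "finite E0"
    using assms by (metis Set.set_insert finite_insert)
  have "signed_sum E0 (\<lambda>A. f (toggle e A)) = signed_sum E0 (\<lambda>A. f (insert e A))"
    "signed_sum E0 (\<lambda>A. f (toggle e (insert e A))) = signed_sum E0 f"
    using E by (auto intro!: signed_sum_cong arg_cong[of _ _ f] simp: toggle_def split: if_splits)
  then show ?thesis using E by (simp add: signed_sum_insert)
qed

text \<open>The terms of \<open>A\<close> and \<open>toggle e A\<close> cancel in pairs. From
  \<open>signed_sum_toggle\<close> it would only follow that twice the sum is zero, which is too
  weak in an arbitrary commutative ring.\<close>

lemma signed_sum_toggle_invariant:
  assumes "finite E" "e \<in> E" and "\<And>A. A \<subseteq> E \<Longrightarrow> f (toggle e A) = f A"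
  shows "signed_sum E f = 0"
proof -
  obtain E0 where E: "E = insert e E0" "e \<notin> E0" "finite E0"
    using assms by (metis Set.set_insert finite_insert)
  have "f (insert e A) = f A" if "A \<subseteq> E0" for A
  proof -
    have "e \<notin> A" using that E by blast
    then show ?thesis using assms(3)[of A] that E by (simp add: toggle_def subset_insertI2)
  qed
  then have "signed_sum E0 (\<lambda>A. f (insert e A)) = signed_sum E0 f"
    by (auto intro: signed_sum_cong)
  then show ?thesis using E by (simp add: signed_sum_insert)
qed

section \<open>Local changes of a ribbon graph\<close>

text \<open>Weaker than \<^const>\<open>ribbon_graph\<close>: the orbits of the rotation may be smaller than the
  vertices, which need not be tracked when a configuration is contracted.\<close>

definition wf_rgraph :: "('v, 'h) rgraph \<Rightarrow> bool" where
  "wf_rgraph \<Gamma> \<longleftrightarrow> finite (halves \<Gamma>) \<and>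
     (\<forall>h\<in>halves \<Gamma>. mate \<Gamma> h \<in> halves \<Gamma> \<and> mate \<Gamma> h \<noteq> h \<and> mate \<Gamma> (mate \<Gamma> h) = h) \<and>
     (\<forall>h\<in>halves \<Gamma>. rot \<Gamma> h \<in> halves \<Gamma> \<and> vert \<Gamma> (rot \<Gamma> h) = vert \<Gamma> h) \<and>
     twisted \<Gamma> \<subseteq> edges \<Gamma>"

lemma wf_rgraph_of_ribbon_graph:
  assumes "ribbon_graph \<Gamma>"
  shows "wf_rgraph \<Gamma>"
proof -
  have "rot \<Gamma> h \<in> halves_at \<Gamma> (vert \<Gamma> h)" if "h \<in> halves \<Gamma>" for h
  proof -
    have h: "h \<in> halves_at \<Gamma> (vert \<Gamma> h)" using that by (simp add: halves_at_def)
    moreover have "vert \<Gamma> h \<in> verts \<Gamma>" using assms that by (auto simp: ribbon_graph_def)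
    ultimately have "cyclic_on (rot \<Gamma>) (halves_at \<Gamma> (vert \<Gamma> h))"
      using assms unfolding ribbon_graph_def by blast
    then show ?thesis using h by (metis cyclic_on_def orbit.step)
  qed
  then show ?thesis
    using assms by (auto simp: wf_rgraph_def ribbon_graph_def halves_at_def)
qed

section \<open>Twists, edges and agreement on half-edges\<close>

lemma add_twists_simps [simp]:
  "verts (add_twists A \<Gamma>) = verts \<Gamma>" "halves (add_twists A \<Gamma>) = halves \<Gamma>"
  "vert (add_twists A \<Gamma>) = vert \<Gamma>" "mate (add_twists A \<Gamma>) = mate \<Gamma>"
  "rot (add_twists A \<Gamma>) = rot \<Gamma>" "edge_of (add_twists A \<Gamma>) = edge_of \<Gamma>"
  "halves_at (add_twists A \<Gamma>) = halves_at \<Gamma>"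
  "e \<in> twisted (add_twists A \<Gamma>) \<longleftrightarrow> (e \<in> twisted \<Gamma>) \<noteq> (e \<in> A)"
  by (auto simp: add_twists_def edge_of_def fun_eq_iff halves_at_def)

text \<open>The fields are total functions of which only the values on half-edges matter; two
  constructions of the same graph may differ at deleted half-edges.\<close>

lemma penrose_cong:
  assumes "verts \<Gamma> = verts \<Gamma>'" "halves \<Gamma> = halves \<Gamma>'" "twisted \<Gamma> = twisted \<Gamma>'"
    and "\<And>h. h \<in> halves \<Gamma>' \<Longrightarrow> vert \<Gamma> h = vert \<Gamma>' h"
    and "\<And>h. h \<in> halves \<Gamma>' \<Longrightarrow> mate \<Gamma> h = mate \<Gamma>' h"
    and "\<And>h. h \<in> halves \<Gamma>' \<Longrightarrow> rot \<Gamma> h = rot \<Gamma>' h"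
  shows "penrose \<Gamma> n = penrose \<Gamma>' n"
proof -
  have e: "edge_of \<Gamma> h = edge_of \<Gamma>' h" if "h \<in> halves \<Gamma>'" for h
    using assms that by (simp add: edge_of_def)
  have "labelling (add_twists A \<Gamma>) = labelling (add_twists A \<Gamma>')" for A
    using assms e by (simp add: labelling_def fun_eq_iff)
  moreover have "halves_at \<Gamma> = halves_at \<Gamma>'"
    using assms by (auto simp: halves_at_def fun_eq_iff)
  ultimately have "boundary_circles (add_twists A \<Gamma>) = boundary_circles (add_twists A \<Gamma>')" for A
    using assms by (simp add: boundary_circles_eq_num_classes)
  moreover have "edges \<Gamma> = edges \<Gamma>'"
    using assms e by (auto simp: edges_def)
  ultimately show ?thesis by (simp add: penrose_def)
qed

lemma edge_of_eq_iff:
  assumes "wf_rgraph \<Gamma>" "h \<in> halves \<Gamma>" "h' \<in> halves \<Gamma>"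
  shows "edge_of \<Gamma> h = edge_of \<Gamma> h' \<longleftrightarrow> h' = h \<or> h' = mate \<Gamma> h"
  using assms by (auto simp: wf_rgraph_def edge_of_def doubleton_eq_iff)

lemma wf_mate:
  assumes "wf_rgraph \<Gamma>" "h \<in> halves \<Gamma>"
  shows "mate \<Gamma> h \<in> halves \<Gamma>" "mate \<Gamma> h \<noteq> h" "mate \<Gamma> (mate \<Gamma> h) = h"
  using assms by (simp_all add: wf_rgraph_def)

lemma edge_of_mate:
  assumes "wf_rgraph \<Gamma>" "h \<in> halves \<Gamma>"
  shows "edge_of \<Gamma> (mate \<Gamma> h) = edge_of \<Gamma> h"
  using wf_mate[OF assms] by (auto simp: edge_of_def)

lemma finite_edges: "wf_rgraph \<Gamma> \<Longrightarrow> finite (edges \<Gamma>)"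
  by (simp add: wf_rgraph_def edges_def)

text \<open>Turning the vertex disc over reverses its cyclic order and adds a half-twist to each of
  its three ribbons, while the surface stays the same. Hence \<open>A\<close> on one side
  corresponds to \<open>A\<close> with three edges toggled on the other, and three toggles give the
  sign -1.\<close>

lemma penrose_reorder3:
  fixes \<Gamma> :: "('a, 'b) rgraph"
  assumes wf: "wf_rgraph \<Gamma>"
    and cw: "clockwise_at \<Gamma> v [s1, s3, s2]"
    and dist: "distinct [edge_of \<Gamma> s1, edge_of \<Gamma> s2, edge_of \<Gamma> s3]"
  shows "penrose \<Gamma> n = - penrose (reorder3 \<Gamma> s1 s2 s3) n"
proof -
  let ?\<Gamma>' = "reorder3 \<Gamma> s1 s2 s3" and ?S = "{s1, s2, s3}"
  let ?tog = "\<lambda>A. toggle (edge_of \<Gamma> s1) (toggle (edge_of \<Gamma> s2) (toggle (edge_of \<Gamma> s3) A))"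
  have S: "?S \<subseteq> halves \<Gamma>" "distinct [s1, s2, s3]"
    using cw by (auto simp: clockwise_at_def halves_at_def)
  have rot: "rot \<Gamma> s1 = s3" "rot \<Gamma> s3 = s2" "rot \<Gamma> s2 = s1"
    using cw by (auto simp: clockwise_at_def All_less_Suc)
  have S_at: "h \<in> ?S \<longleftrightarrow> h \<in> halves \<Gamma> \<and> vert \<Gamma> h = v" for h
    using cw by (auto simp: clockwise_at_def halves_at_def)
  have rot_S: "rot \<Gamma> h \<in> ?S \<longleftrightarrow> h \<in> ?S" if "h \<in> halves \<Gamma>" for h
    using that wf unfolding S_at by (auto simp: wf_rgraph_def)
  have edge_eq: "edge_of \<Gamma> h = edge_of \<Gamma> s \<longleftrightarrow> h = s \<or> mate \<Gamma> h = s"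
    if "h \<in> halves \<Gamma>" "s \<in> ?S" for h s
    using edge_of_eq_iff[OF wf that(1), of s] S that by auto
  \<comment> \<open>As the three edges are distinct, none is a loop at the vertex: a loop would be
    flipped at both ends and gain two half-twists, that is none.\<close>
  have mate_S: "mate \<Gamma> h \<notin> ?S" if "h \<in> ?S" for h
  proof
    assume "mate \<Gamma> h \<in> ?S"
    moreover have "h \<in> halves \<Gamma>" using that S by blast
    then have "edge_of \<Gamma> (mate \<Gamma> h) = edge_of \<Gamma> h" "mate \<Gamma> h \<noteq> h"
      using wf_mate[OF wf] edge_of_mate[OF wf] by simp_all
    ultimately show False using that dist by (elim insertE emptyE) simp_all
  qed
  have edge_S: "edge_of \<Gamma> h \<in> ?tog A \<longleftrightarrow> (edge_of \<Gamma> h \<in> A) \<noteq> (h \<in> ?S \<or> mate \<Gamma> h \<in> ?S)"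
    if "h \<in> halves \<Gamma>" for h A
  proof -
    have eq: "edge_of \<Gamma> h = edge_of \<Gamma> s1 \<longleftrightarrow> h = s1 \<or> mate \<Gamma> h = s1"
      "edge_of \<Gamma> h = edge_of \<Gamma> s2 \<longleftrightarrow> h = s2 \<or> mate \<Gamma> h = s2"
      "edge_of \<Gamma> h = edge_of \<Gamma> s3 \<longleftrightarrow> h = s3 \<or> mate \<Gamma> h = s3"
      using edge_eq[OF that] by blast+
    show ?thesis unfolding mem_toggle3_iff[OF dist] eq by blast
  qed
  have edge_of': "edge_of ?\<Gamma>' = edge_of \<Gamma>" by (auto simp: reorder3_def edge_of_def fun_eq_iff)
  \<comment> \<open>\<open>?f\<close> exchanges the two sides of each of the three half-edges. It is
    an involution, so it transports labellings both ways.\<close>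
  let ?f = "\<lambda>(h, x). (h, x \<noteq> (h \<in> ?S))"
  have circles: "boundary_circles (add_twists A \<Gamma>) = boundary_circles (add_twists (?tog A) ?\<Gamma>')" for A
  proof -
    have lab: "labelling (add_twists A \<Gamma>) (g \<circ> ?f) = labelling (add_twists (?tog A) ?\<Gamma>') g" for g
    proof -
      have split: "(\<forall>h\<in>halves \<Gamma>. P h) \<longleftrightarrow> P s1 \<and> P s2 \<and> P s3 \<and> (\<forall>h\<in>halves \<Gamma> - ?S. P h)" for P
        using S by auto
      \<comment> \<open>With sides exchanged, the arc from a half-edge to its successor becomes an
        arc from the successor back to it, which belongs to the reversed order.\<close>
      have 1: "(\<forall>h\<in>halves \<Gamma>. (g \<circ> ?f) (h, True) = (g \<circ> ?f) (rot \<Gamma> h, False)) \<longleftrightarrow>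
          (\<forall>h\<in>halves \<Gamma>. g (h, True) = g (rot ?\<Gamma>' h, False))"
      proof -
        have "(\<forall>h\<in>halves \<Gamma> - ?S. (g \<circ> ?f) (h, True) = (g \<circ> ?f) (rot \<Gamma> h, False)) \<longleftrightarrow>
          (\<forall>h\<in>halves \<Gamma> - ?S. g (h, True) = g (rot ?\<Gamma>' h, False))"
          by (intro ball_cong refl) (use rot_S in \<open>auto simp: reorder3_def\<close>)
        then show ?thesis
          unfolding split using S(2) rot by (auto simp: reorder3_def)
      qed
      have 2: "(\<forall>x. (g \<circ> ?f) (h, x)
            = (g \<circ> ?f) (mate \<Gamma> h, x = (edge_of \<Gamma> h \<in> twisted (add_twists A \<Gamma>)))) \<longleftrightarrow>
          (\<forall>x. g (h, x) = g (mate \<Gamma> h, x = (edge_of \<Gamma> h \<in> twisted (add_twists (?tog A) ?\<Gamma>'))))"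
        if "h \<in> halves \<Gamma>" for h
      proof -
        have tw: "edge_of \<Gamma> h \<in> twisted (add_twists (?tog A) ?\<Gamma>') \<longleftrightarrow>
          ((edge_of \<Gamma> h \<in> twisted (add_twists A \<Gamma>)) \<noteq> (h \<in> ?S \<or> mate \<Gamma> h \<in> ?S))"
          unfolding add_twists_simps edge_S[OF that] by (auto simp: reorder3_def)
        show ?thesis
          unfolding tw using mate_S[of h]
          by (cases "h \<in> ?S"; cases "mate \<Gamma> h \<in> ?S") (auto simp: all_bool_eq)
      qed
      show ?thesis
        unfolding labelling_def using 1 2 edge_of' by (simp add: ball_conj_distrib reorder3_def)
    qed
    have ff: "?f \<circ> ?f = id" by (auto simp: fun_eq_iff)
    have "num_classes (halves \<Gamma> \<times> UNIV) (labelling (add_twists A \<Gamma>))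
        = num_classes (halves \<Gamma> \<times> UNIV) (labelling (add_twists (?tog A) ?\<Gamma>'))"
    proof (rule num_classes_eqI)
      show "?f ` (halves \<Gamma> \<times> UNIV) = halves \<Gamma> \<times> UNIV"
      proof
        show "halves \<Gamma> \<times> UNIV \<subseteq> ?f ` (halves \<Gamma> \<times> UNIV)"
        proof
          fix p assume "p \<in> halves \<Gamma> \<times> (UNIV :: bool set)"
          then have "?f p \<in> halves \<Gamma> \<times> UNIV" "p = ?f (?f p)" by auto
          then show "p \<in> ?f ` (halves \<Gamma> \<times> UNIV)" by (rule rev_image_eqI)
        qed
      qed auto
      show "labelling (add_twists A \<Gamma>) (g \<circ> ?f)" if "labelling (add_twists (?tog A) ?\<Gamma>') g" for g
        using that unfolding lab .
      show "labelling (add_twists (?tog A) ?\<Gamma>') (g \<circ> ?f)" if "labelling (add_twists A \<Gamma>) g" for g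
        using that ff unfolding lab[symmetric] by (simp add: comp_assoc)
      show "g (?f (?f p)) = g p" for g and p :: "'b \<times> bool"
        by (rule arg_cong[of _ _ g]) (cases p; auto)
    qed
    then show ?thesis
      by (simp add: boundary_circles_eq_num_classes reorder3_def halves_at_def)
  qed
  have fin: "finite (edges \<Gamma>)" by (rule finite_edges[OF wf])
  have in_edges: "edge_of \<Gamma> s1 \<in> edges \<Gamma>" "edge_of \<Gamma> s2 \<in> edges \<Gamma>" "edge_of \<Gamma> s3 \<in> edges \<Gamma>"
    using S by (auto simp: edges_def)
  let ?b' = "\<lambda>A. n ^ boundary_circles (add_twists A ?\<Gamma>')"
  have "penrose \<Gamma> n = signed_sum (edges \<Gamma>) (\<lambda>A. ?b' (?tog A))"
    by (simp add: penrose_eq_signed_sum circles)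
  also have "\<dots> = - signed_sum (edges \<Gamma>) ?b'"
    using signed_sum_toggle[OF fin in_edges(3),
        of "\<lambda>A. ?b' (toggle (edge_of \<Gamma> s1) (toggle (edge_of \<Gamma> s2) A))"]
      signed_sum_toggle[OF fin in_edges(2), of "\<lambda>A. ?b' (toggle (edge_of \<Gamma> s1) A)"]
      signed_sum_toggle[OF fin in_edges(1), of ?b']
    by simp
  also have "edges \<Gamma> = edges ?\<Gamma>'"
    using edge_of' by (simp add: edges_def) (simp add: reorder3_def)
  finally show ?thesis by (simp add: penrose_eq_signed_sum)
qed

text \<open>The disc of a degree-2 vertex only prolongs one ribbon into the other, so the circles
  depend on the half-twists of the two edges through their sum modulo 2. Of the four choices of
  twists, two (both with sign +1) leave the joined edge as it is and two (both with sign -1) twist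
  it, whence the factor 2.\<close>

lemma penrose_delete_and_join:
  fixes \<Gamma> :: "('v, 'h) rgraph"
  assumes wf: "wf_rgraph \<Gamma>"
    and cw: "clockwise_at \<Gamma> v [s1, s2]"
    and dist: "edge_of \<Gamma> s1 \<noteq> edge_of \<Gamma> s2"
  shows "penrose \<Gamma> n = 2 * penrose (delete_and_join \<Gamma> {v} s1 s2) n"
proof -
  define g1 g2 where "g1 = mate \<Gamma> s1" and "g2 = mate \<Gamma> s2"
  define H where "H = halves \<Gamma> - {s1, s2, g1, g2}"
  define e1 e2 e' where "e1 = edge_of \<Gamma> s1" and "e2 = edge_of \<Gamma> s2" and "e' = {g1, g2}"
  define E where "E = edge_of \<Gamma> ` H"
  define J where "J = delete_and_join \<Gamma> {v} s1 s2"
  have s: "s1 \<in> halves \<Gamma>" "s2 \<in> halves \<Gamma>" "s1 \<noteq> s2" "v \<in> verts \<Gamma>" "vert \<Gamma> s1 = v" "vert \<Gamma> s2 = v"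
    using cw by (auto simp: clockwise_at_def halves_at_def)
  have rot: "rot \<Gamma> s1 = s2" "rot \<Gamma> s2 = s1"
    using cw by (auto simp: clockwise_at_def All_less_Suc)
  have s_at: "vert \<Gamma> h = v \<longleftrightarrow> h = s1 \<or> h = s2" if "h \<in> halves \<Gamma>" for h
    using cw that by (auto simp: clockwise_at_def halves_at_def)
  have g: "g1 \<in> halves \<Gamma>" "g2 \<in> halves \<Gamma>" "mate \<Gamma> g1 = s1" "mate \<Gamma> g2 = s2" "g1 \<noteq> s1" "g2 \<noteq> s2"
    unfolding g1_def g2_def using wf_mate[OF wf] s by simp_all
  \<comment> \<open>Since the emanating edges are distinct, they do not form one loop from
    \<open>s1\<close> to \<open>s2\<close>, and the four half-edges involved are distinct.\<close>
  have g': "g1 \<noteq> s2" "g2 \<noteq> s1" "g1 \<noteq> g2"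
    using dist edge_of_mate[OF wf s(1)] edge_of_mate[OF wf s(2)] g s unfolding g1_def[symmetric] g2_def[symmetric]
    by auto
  note neq = s(3) g(5,6) g' not_sym[OF s(3)] not_sym[OF g(5)] not_sym[OF g(6)] not_sym[OF g'(1)]
    not_sym[OF g'(2)] not_sym[OF g'(3)]
  have mate: "mate \<Gamma> s1 = g1" "mate \<Gamma> s2 = g2" by (simp_all add: g1_def g2_def)
  have halves: "halves \<Gamma> = insert s1 (insert s2 (insert g1 (insert g2 H)))"
    using s g by (auto simp: H_def)
  have H: "h \<in> halves \<Gamma>" "h \<noteq> s1" "h \<noteq> s2" "h \<noteq> g1" "h \<noteq> g2" if "h \<in> H" for h
    using that by (auto simp: H_def)
  have mate_H: "mate \<Gamma> h \<in> H" if "h \<in> H" for h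
  proof -
    have "mate \<Gamma> (mate \<Gamma> h) = h" "mate \<Gamma> h \<in> halves \<Gamma>" using wf_mate[OF wf H(1)] that by auto
    then show ?thesis using H[OF that] mate g unfolding H_def by auto
  qed
  have rot_out: "rot \<Gamma> h \<notin> {s1, s2}" if "h \<in> insert g1 (insert g2 H)" for h
  proof -
    have h: "h \<in> halves \<Gamma>" "h \<noteq> s1" "h \<noteq> s2" using that neq H g by auto
    then have "rot \<Gamma> h \<in> halves \<Gamma>" "vert \<Gamma> (rot \<Gamma> h) = vert \<Gamma> h"
      using wf by (auto simp: wf_rgraph_def)
    then show ?thesis using s_at[of h] s_at[of "rot \<Gamma> h"] h by auto
  qed
  have halves_J: "halves J = insert g1 (insert g2 H)"
  proof -
    have "halves J = {h \<in> halves \<Gamma>. vert \<Gamma> h \<noteq> v}"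
      by (simp add: J_def delete_and_join_def Let_def)
    also have "\<dots> = halves \<Gamma> - {s1, s2}" using s_at by auto
    finally show ?thesis unfolding halves using neq H by auto
  qed
  have mate_J: "mate J g1 = g2" "mate J g2 = g1" "\<And>h. h \<in> H \<Longrightarrow> mate J h = mate \<Gamma> h"
    using neq H by (auto simp: J_def delete_and_join_def Let_def mate)
  have rot_J: "rot J = rot \<Gamma>" by (simp add: J_def delete_and_join_def Let_def)
  have edge_J: "edge_of J g1 = e'" "edge_of J g2 = e'" "\<And>h. h \<in> H \<Longrightarrow> edge_of J h = edge_of \<Gamma> h"
    by (auto simp: edge_of_def mate_J e'_def)
  have edge_g: "edge_of \<Gamma> g1 = e1" "edge_of \<Gamma> g2 = e2"
    using edge_of_mate[OF wf s(1)] edge_of_mate[OF wf s(2)] by (simp_all add: mate e1_def e2_def)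
  \<comment> \<open>The joined edge is new, so its half-twist in \<open>J\<close> is not inherited
    from \<open>twisted \<Gamma>\<close> but comes only from the sum of the two old ones.\<close>
  have e'_not: "e' \<notin> edges \<Gamma>"
  proof
    assume "e' \<in> edges \<Gamma>"
    then obtain h where h: "h \<in> halves \<Gamma>" "{g1, g2} = {h, mate \<Gamma> h}"
      by (auto simp: edges_def e'_def edge_of_def)
    then have "mate \<Gamma> g1 = g2" using wf_mate[OF wf h(1)] by (auto simp: doubleton_eq_iff)
    then show False using g neq by simp
  qed
  have edges: "edges \<Gamma> = insert e1 (insert e2 E)" "edges J = insert e' E"
    unfolding edges_def E_def using edge_J edge_g
    by (auto simp: halves halves_J e1_def[symmetric] e2_def[symmetric] cong: image_cong)
  have E_sub: "E \<subseteq> Pow H"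
    using mate_H by (auto simp: E_def edge_of_def)
  have notin: "e1 \<notin> E" "e2 \<notin> E" "e' \<notin> E" "e1 \<noteq> e2"
    using E_sub dist H(2)[of s1] H(3)[of s2] e'_not edges(1)
    by (auto simp: e1_def e2_def edge_of_def)
  have finE: "finite E" using finite_edges[OF wf] edges by simp
  have twisted_J: "twisted J = {e \<in> twisted \<Gamma>. e \<subseteq> halves J} \<union>
      (if (e1 \<in> twisted \<Gamma>) \<noteq> (e2 \<in> twisted \<Gamma>) then {e'} else {})"
    by (simp add: J_def delete_and_join_def Let_def e1_def e2_def e'_def mate)
  have tw_e': "e' \<in> twisted J \<longleftrightarrow> (e1 \<in> twisted \<Gamma>) \<noteq> (e2 \<in> twisted \<Gamma>)"
    using e'_not wf unfolding twisted_J wf_rgraph_def by auto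
  have tw_E: "e \<in> twisted J \<longleftrightarrow> e \<in> twisted \<Gamma>" if "e \<in> E" for e
  proof -
    have "e \<noteq> e'" "e \<subseteq> halves J" using that notin E_sub halves_J by auto
    then show ?thesis unfolding twisted_J by simp
  qed
  have circles: "boundary_circles (add_twists B \<Gamma>) = boundary_circles (add_twists B' J)"
    if BE: "\<And>e. e \<in> E \<Longrightarrow> e \<in> B \<longleftrightarrow> e \<in> B'" and Be: "(e1 \<in> B) \<noteq> (e2 \<in> B) \<longleftrightarrow> e' \<in> B'" for B B'
  proof -
    \<comment> \<open>\<open>t1\<close> and \<open>t2\<close> tell whether the two emanating ribbons
      are half-twisted once \<open>B\<close> is applied; the joined ribbon is then half-twisted iff
      \<open>t1 \<noteq> t2\<close>.\<close>
    define t1 t2 where "t1 \<longleftrightarrow> (e1 \<in> twisted \<Gamma>) \<noteq> (e1 \<in> B)" and "t2 \<longleftrightarrow> (e2 \<in> twisted \<Gamma>) \<noteq> (e2 \<in> B)"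
    \<comment> \<open>The sides of \<open>s1\<close> and \<open>s2\<close> slide along their ribbons
      to the far ends \<open>g1\<close> and \<open>g2\<close>, which survive in
      \<open>J\<close>.\<close>
    let ?f = "\<lambda>(h, x). if h = s1 then (g1, x = t1) else if h = s2 then (g2, x = t2) else (h, x)"
    let ?outer = "\<lambda>g. (\<forall>h\<in>insert g1 (insert g2 H). g (h, True) = g (rot \<Gamma> h, False)) \<and>
      (\<forall>h\<in>H. \<forall>x. g (h, x) = g (mate \<Gamma> h, x = ((edge_of \<Gamma> h \<in> twisted \<Gamma>) \<noteq> (edge_of \<Gamma> h \<in> B))))"
    have lab: "labelling (add_twists B \<Gamma>) g \<longleftrightarrow> ?outer g \<and> g (s1, True) = g (s2, False) \<and>
        g (s2, True) = g (s1, False) \<and> (\<forall>x. g (s1, x) = g (g1, x = t1)) \<and> (\<forall>x. g (s2, x) = g (g2, x = t2))"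
      for g
      unfolding labelling_def add_twists_simps halves ball_conj_distrib ball_simps(7) rot mate g(3,4)
        edge_g e1_def[symmetric] e2_def[symmetric] t1_def[symmetric] t2_def[symmetric]
      by (cases t1; cases t2; simp only: all_bool_eq simp_thms; blast)
    have tw': "(e' \<in> twisted J) \<noteq> (e' \<in> B') \<longleftrightarrow> t1 \<noteq> t2"
      using tw_e' Be unfolding t1_def t2_def by blast
    have H_J: "(\<forall>h\<in>H. \<forall>x. g (h, x)
          = g (mate J h, x = ((edge_of J h \<in> twisted J) \<noteq> (edge_of J h \<in> B')))) \<longleftrightarrow>
        (\<forall>h\<in>H. \<forall>x. g (h, x) = g (mate \<Gamma> h, x = ((edge_of \<Gamma> h \<in> twisted \<Gamma>) \<noteq> (edge_of \<Gamma> h \<in> B))))"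
      for g
      by (intro ball_cong refl) (simp add: mate_J edge_J tw_E BE E_def)
    have lab': "labelling (add_twists B' J) g \<longleftrightarrow> ?outer g \<and> (\<forall>x. g (g1, x) = g (g2, x = (t1 \<noteq> t2)))"
      for g
      unfolding labelling_def add_twists_simps halves_J ball_conj_distrib ball_simps(7) H_J
        mate_J(1,2) edge_J(1,2) rot_J tw'
      by (cases t1; cases t2; simp only: all_bool_eq simp_thms; blast)
    have H': "h \<noteq> s1 \<and> h \<noteq> s2" if "h \<in> insert g1 (insert g2 H)" for h
      using that neq H by auto
    have outer: "?outer (g \<circ> ?f) \<longleftrightarrow> ?outer g" for g
    proof (intro arg_cong2[of _ _ _ _ "(\<and>)"] ball_cong refl)
      fix h assume h: "h \<in> insert g1 (insert g2 H)"
      show "(g \<circ> ?f) (h, True) = (g \<circ> ?f) (rot \<Gamma> h, False) \<longleftrightarrow> g (h, True) = g (rot \<Gamma> h, False)"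
        using H'[OF h] rot_out[OF h] by simp
    next
      fix h assume h: "h \<in> H"
      show "(\<forall>x. (g \<circ> ?f) (h, x)
          = (g \<circ> ?f) (mate \<Gamma> h, x = ((edge_of \<Gamma> h \<in> twisted \<Gamma>) \<noteq> (edge_of \<Gamma> h \<in> B)))) \<longleftrightarrow>
        (\<forall>x. g (h, x) = g (mate \<Gamma> h, x = ((edge_of \<Gamma> h \<in> twisted \<Gamma>) \<noteq> (edge_of \<Gamma> h \<in> B))))"
        using H[OF h] H[OF mate_H[OF h]] by simp
    qed
    have "num_classes (halves \<Gamma> \<times> UNIV) (labelling (add_twists B \<Gamma>))
        = num_classes (halves J \<times> UNIV) (labelling (add_twists B' J))"
    proof (rule num_classes_eqI)
      show "?f ` (halves \<Gamma> \<times> UNIV) = halves J \<times> UNIV"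
      proof
        show "?f ` (halves \<Gamma> \<times> UNIV) \<subseteq> halves J \<times> UNIV"
          unfolding halves halves_J by (auto split: if_splits)
        show "halves J \<times> UNIV \<subseteq> ?f ` (halves \<Gamma> \<times> UNIV)"
        proof
          fix p assume "p \<in> halves J \<times> (UNIV :: bool set)"
          then have "p \<in> halves \<Gamma> \<times> UNIV" "p = ?f p"
            using H' unfolding halves halves_J by auto
          then show "p \<in> ?f ` (halves \<Gamma> \<times> UNIV)" by (rule rev_image_eqI)
        qed
      qed
      show "labelling (add_twists B \<Gamma>) (g \<circ> ?f)" if "labelling (add_twists B' J) g" for g
      proof -
        have o: "?outer g" and e: "\<forall>x. g (g1, x) = g (g2, x = (t1 \<noteq> t2))"
          using that unfolding lab' by blast+
        have "(g \<circ> ?f) (s1, True) = (g \<circ> ?f) (s2, False) \<and> (g \<circ> ?f) (s2, True) = (g \<circ> ?f) (s1, False) \<and>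
            (\<forall>x. (g \<circ> ?f) (s1, x) = (g \<circ> ?f) (g1, x = t1)) \<and>
            (\<forall>x. (g \<circ> ?f) (s2, x) = (g \<circ> ?f) (g2, x = t2))"
          using e neq by (cases t1; cases t2) (simp_all add: all_bool_eq)
        with o show ?thesis unfolding lab outer by blast
      qed
      \<comment> \<open>Following one ribbon, an arc of the disc and the other ribbon yields the
        condition on the joined ribbon, so the labelling needs no change.\<close>
      show "labelling (add_twists B' J) (g \<circ> id)" if "labelling (add_twists B \<Gamma>) g" for g
      proof -
        have o: "?outer g" and e: "g (s1, True) = g (s2, False)" "g (s2, True) = g (s1, False)"
            "\<forall>x. g (s1, x) = g (g1, x = t1)" "\<forall>x. g (s2, x) = g (g2, x = t2)"
          using that unfolding lab by blast+
        have "\<forall>x. g (g1, x) = g (g2, x = (t1 \<noteq> t2))"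
          using e by (cases t1; cases t2) (simp_all add: all_bool_eq)
        with o show ?thesis unfolding lab' comp_id by blast
      qed
      show "g (id (?f p)) = g p" if "labelling (add_twists B \<Gamma>) g" for g and p :: "'h \<times> bool"
      proof -
        obtain h x where p: "p = (h, x)" by (cases p)
        have "g (s1, x) = g (g1, x = t1)" "g (s2, x) = g (g2, x = t2)"
          using that unfolding lab by blast+
        then show ?thesis unfolding p by simp
      qed
    qed
    moreover have "{u \<in> verts J. halves_at J u = {}} = {u \<in> verts \<Gamma>. halves_at \<Gamma> u = {}}"
    proof -
      have "verts J = verts \<Gamma> - {v}" "vert J = vert \<Gamma>"
        by (simp_all add: J_def delete_and_join_def Let_def)
      then show ?thesis
        using s unfolding halves_at_def halves halves_J by auto
    qed
    ultimately show ?thesis by (simp add: boundary_circles_eq_num_classes)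
  qed
  let ?b = "\<lambda>A. n ^ boundary_circles (add_twists A \<Gamma>)"
  let ?b' = "\<lambda>A. n ^ boundary_circles (add_twists A J)"
  \<comment> \<open>These are the four choices of twists on \<open>e1\<close> and \<open>e2\<close>,
    matched with the two choices on the joined edge.\<close>
  have "signed_sum E ?b = signed_sum E ?b'"
    "signed_sum E (\<lambda>A. ?b (insert e1 A)) = signed_sum E (\<lambda>A. ?b' (insert e' A))"
    "signed_sum E (\<lambda>A. ?b (insert e2 A)) = signed_sum E (\<lambda>A. ?b' (insert e' A))"
    "signed_sum E (\<lambda>A. ?b (insert e1 (insert e2 A))) = signed_sum E ?b'"
    using notin by (auto intro!: signed_sum_cong arg_cong[of _ _ "power n"] circles)
  then show ?thesis
    unfolding penrose_eq_signed_sum J_def[symmetric] edges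
    using notin finE by (simp add: signed_sum_insert algebra_simps)
qed

section \<open>Contraction of a configuration to a single vertex\<close>

text \<open>The new rotation \<open>r\<close> is a parameter because the triangle is contracted to a
  vertex with either of the two cyclic orders.\<close>

definition contract ::
  "('v, 'h) rgraph \<Rightarrow> 'v set \<Rightarrow> 'v \<Rightarrow> 'h set \<Rightarrow> ('h \<Rightarrow> 'h) \<Rightarrow> ('v, 'h) rgraph" where
  "contract \<Gamma> W w S r =
     \<Gamma>\<lparr>verts := verts \<Gamma> - (W - {w}), halves := {h \<in> halves \<Gamma>. vert \<Gamma> h \<notin> W} \<union> S,
       vert := (\<lambda>h. if h \<in> S then w else vert \<Gamma> h), rot := r\<rparr>"

lemma contract_simps [simp]:
  "verts (contract \<Gamma> W w S r) = verts \<Gamma> - (W - {w})"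
  "halves (contract \<Gamma> W w S r) = {h \<in> halves \<Gamma>. vert \<Gamma> h \<notin> W} \<union> S"
  "vert (contract \<Gamma> W w S r) = (\<lambda>h. if h \<in> S then w else vert \<Gamma> h)"
  "mate (contract \<Gamma> W w S r) = mate \<Gamma>"
  "rot (contract \<Gamma> W w S r) = r"
  "twisted (contract \<Gamma> W w S r) = twisted \<Gamma>"
  "edge_of (contract \<Gamma> W w S r) = edge_of \<Gamma>"
  by (auto simp: contract_def edge_of_def fun_eq_iff)

text \<open>\<open>S\<close> consists of the emanating half-edges and \<open>I\<close> of the halves
  of the inner edges. Inner edges are untwisted, so after twisting their state is given by the
  chosen subset alone. Vertices of \<open>W\<close> must not be isolated, since each isolated disc
  counts as a boundary circle.\<close>

locale contraction =
  fixes \<Gamma> :: "('v, 'h) rgraph" and W :: "'v set" and w :: 'v and S I :: "'h set" and r :: "'h \<Rightarrow> 'h"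
  assumes wf: "wf_rgraph \<Gamma>"
    and w: "w \<in> W" "W \<subseteq> verts \<Gamma>"
    and W_halves: "{h \<in> halves \<Gamma>. vert \<Gamma> h \<in> W} = S \<union> I" "S \<inter> I = {}" "S \<noteq> {}"
    and W_nonisolated: "\<And>u. u \<in> W \<Longrightarrow> halves_at \<Gamma> u \<noteq> {}"
    and mate_I: "\<And>h. h \<in> I \<Longrightarrow> mate \<Gamma> h \<in> I"
    and untwisted_I: "\<And>h. h \<in> I \<Longrightarrow> edge_of \<Gamma> h \<notin> twisted \<Gamma>"
    and r_S: "\<And>h. h \<in> S \<Longrightarrow> r h \<in> S"
    and r_outer: "\<And>h. h \<notin> S \<Longrightarrow> r h = rot \<Gamma> h"
begin

section \<open>Splitting the boundary into an inner and an outer part\<close>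

definition outer where "outer = {h \<in> halves \<Gamma>. vert \<Gamma> h \<notin> W}"

abbreviation \<Gamma>' where "\<Gamma>' \<equiv> contract \<Gamma> W w S r"

text \<open>The inner part comprises the vertex discs of \<open>W\<close> and the inner ribbons; the
  emanating ribbons belong to \<open>outer_labelling\<close>. The outer part is common to \<Gamma>
  and \<open>\<Gamma>'\<close>, so comparing circles reduces to comparing
  \<open>inner_labelling\<close> with the arcs of the new vertex.\<close>

definition inner_labelling :: "'h set set \<Rightarrow> ('h \<times> bool \<Rightarrow> bool) \<Rightarrow> bool" where
  "inner_labelling D g \<longleftrightarrow> (\<forall>h\<in>S \<union> I. g (h, True) = g (rot \<Gamma> h, False)) \<and>
     (\<forall>h\<in>I. \<forall>x. g (h, x) = g (mate \<Gamma> h, x = (edge_of \<Gamma> h \<in> D)))"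

definition outer_labelling :: "'h set set \<Rightarrow> ('h \<times> bool \<Rightarrow> bool) \<Rightarrow> bool" where
  "outer_labelling A g \<longleftrightarrow> (\<forall>h\<in>outer. g (h, True) = g (rot \<Gamma> h, False)) \<and>
     (\<forall>h\<in>outer \<union> S. \<forall>x.
        g (h, x) = g (mate \<Gamma> h, x = ((edge_of \<Gamma> h \<in> twisted \<Gamma>) \<noteq> (edge_of \<Gamma> h \<in> A))))"

lemma halves_eq: "halves \<Gamma> = outer \<union> S \<union> I" "halves \<Gamma>' = outer \<union> S"
  and disjoint: "outer \<inter> S = {}" "outer \<inter> I = {}"
  using W_halves by (auto simp: outer_def)

lemma not_inner: "h \<in> outer \<union> S \<Longrightarrow> h \<notin> I"
  using disjoint W_halves(2) by blast

lemma mate_outer: "h \<in> outer \<union> S \<Longrightarrow> mate \<Gamma> h \<in> outer \<union> S"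
  using wf_mate[OF wf, of h] mate_I[of "mate \<Gamma> h"] halves_eq(1) disjoint W_halves(2) by auto

lemma rot_outer: "h \<in> outer \<Longrightarrow> rot \<Gamma> h \<in> outer"
  using wf by (auto simp: outer_def wf_rgraph_def)

lemma edges_eq: "edges \<Gamma> = edges \<Gamma>' \<union> edge_of \<Gamma> ` I" "edges \<Gamma>' = edge_of \<Gamma> ` (outer \<union> S)"
  by (auto simp: edges_def halves_eq simp del: contract_simps(2))

lemma edges_disjoint: "edges \<Gamma>' \<inter> edge_of \<Gamma> ` I = {}"
proof -
  have "edge_of \<Gamma> h \<noteq> edge_of \<Gamma> h'" if "h \<in> outer \<union> S" "h' \<in> I" for h h'
  proof
    assume "edge_of \<Gamma> h = edge_of \<Gamma> h'"
    then have "h = h' \<or> h = mate \<Gamma> h'" by (auto simp: edge_of_def doubleton_eq_iff)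
    then show False using that mate_I[OF that(2)] disjoint W_halves(2) by auto
  qed
  then show ?thesis unfolding edges_eq by auto
qed

text \<open>Every twisted edge survives because no inner edge is twisted, and mates stay within the
  remaining half-edges because inner half-edges are paired among themselves.\<close>

lemma wf_contract: "wf_rgraph \<Gamma>'"
proof -
  have "twisted \<Gamma> \<subseteq> edges \<Gamma>'"
    using wf untwisted_I edges_eq(1) unfolding wf_rgraph_def by auto
  moreover have "finite (outer \<union> S)" using wf halves_eq(1) by (auto simp: wf_rgraph_def)
  moreover have "r h \<in> outer \<union> S \<and> vert \<Gamma>' (r h) = vert \<Gamma>' h" if "h \<in> outer \<union> S" for h
  proof (cases "h \<in> S")
    case True
    then show ?thesis using r_S by simp
  next
    case False
    then have "h \<in> outer" using that by blast
    then have "rot \<Gamma> h \<in> outer" "rot \<Gamma> h \<notin> S" "vert \<Gamma> (rot \<Gamma> h) = vert \<Gamma> h"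
      using rot_outer[of h] disjoint wf by (auto simp: wf_rgraph_def outer_def)
    then show ?thesis using False r_outer by simp
  qed
  moreover have "mate \<Gamma> h \<in> outer \<union> S \<and> mate \<Gamma> h \<noteq> h \<and> mate \<Gamma> (mate \<Gamma> h) = h"
    if "h \<in> outer \<union> S" for h
    using mate_outer[OF that] wf_mate[OF wf, of h] that halves_eq(1) by auto
  ultimately show ?thesis
    unfolding wf_rgraph_def halves_eq(2) contract_simps(4-6) by blast
qed

text \<open>No vertex of \<open>W\<close> was isolated, and the new vertex carries the nonempty set
  \<open>S\<close>.\<close>

lemma isolated_contract:
  "{u \<in> verts \<Gamma>'. halves_at \<Gamma>' u = {}} = {u \<in> verts \<Gamma>. halves_at \<Gamma> u = {}}"
proof -
  have at: "halves_at \<Gamma>' u = halves_at \<Gamma> u" if "u \<notin> W" for u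
    using that w W_halves(1) unfolding halves_at_def by auto
  have "halves_at \<Gamma>' w \<noteq> {}"
    using W_halves(3) unfolding halves_at_def by auto
  then have "u \<in> verts \<Gamma>' \<and> halves_at \<Gamma>' u = {} \<longleftrightarrow> u \<in> verts \<Gamma> \<and> halves_at \<Gamma> u = {}" for u
    using at[of u] W_nonisolated[of u] by (cases "u \<in> W"; cases "u = w") auto
  then show ?thesis by blast
qed

lemma labelling_iff:
  assumes "A \<subseteq> edges \<Gamma>'" "D \<subseteq> edge_of \<Gamma> ` I"
  shows "labelling (add_twists (A \<union> D) \<Gamma>) g \<longleftrightarrow> inner_labelling D g \<and> outer_labelling A g"
proof -
  have I: "(edge_of \<Gamma> h \<in> twisted \<Gamma>) \<noteq> (edge_of \<Gamma> h \<in> A \<union> D) \<longleftrightarrow> edge_of \<Gamma> h \<in> D" if "h \<in> I" for h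
    using untwisted_I[OF that] edges_disjoint assms(1) that by auto
  have O: "edge_of \<Gamma> h \<in> A \<union> D \<longleftrightarrow> edge_of \<Gamma> h \<in> A" if "h \<in> outer \<union> S" for h
    using edges_disjoint assms(2) that unfolding edges_eq(2) by auto
  have 1: "(\<forall>h\<in>I. \<forall>x. g (h, x) =
        g (mate \<Gamma> h, x = ((edge_of \<Gamma> h \<in> twisted \<Gamma>) \<noteq> (edge_of \<Gamma> h \<in> A \<union> D)))) \<longleftrightarrow>
      (\<forall>h\<in>I. \<forall>x. g (h, x) = g (mate \<Gamma> h, x = (edge_of \<Gamma> h \<in> D)))"
    by (intro ball_cong refl) (simp only: I)
  have 2: "(\<forall>h\<in>outer \<union> S. \<forall>x. g (h, x) =
        g (mate \<Gamma> h, x = ((edge_of \<Gamma> h \<in> twisted \<Gamma>) \<noteq> (edge_of \<Gamma> h \<in> A \<union> D)))) \<longleftrightarrow>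
      (\<forall>h\<in>outer \<union> S. \<forall>x. g (h, x) =
        g (mate \<Gamma> h, x = ((edge_of \<Gamma> h \<in> twisted \<Gamma>) \<noteq> (edge_of \<Gamma> h \<in> A))))"
    by (intro ball_cong refl) (simp only: O)
  show ?thesis
    unfolding labelling_def inner_labelling_def outer_labelling_def add_twists_simps halves_eq(1)
      ball_conj_distrib ball_Un 1 2[unfolded ball_Un] by (simp only: conj_ac)
qed

lemma labelling_contract_iff:
  "labelling (add_twists A \<Gamma>') g \<longleftrightarrow> (\<forall>h\<in>S. g (h, True) = g (r h, False)) \<and> outer_labelling A g"
proof -
  have "r h = rot \<Gamma> h" if "h \<in> outer" for h
    using r_outer disjoint that by blast
  then have "(\<forall>h\<in>outer. g (h, True) = g (r h, False)) \<longleftrightarrow> (\<forall>h\<in>outer. g (h, True) = g (rot \<Gamma> h, False))"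
    by (intro ball_cong refl) simp
  then show ?thesis
    unfolding labelling_def outer_labelling_def add_twists_simps halves_eq(2) contract_simps(4-7)
      ball_conj_distrib ball_Un by (simp only: conj_ac)
qed

lemma outer_labelling_cong:
  assumes "\<And>h x. h \<in> outer \<union> S \<Longrightarrow> g (h, x) = g' (h, x)"
  shows "outer_labelling A g \<longleftrightarrow> outer_labelling A g'"
  unfolding outer_labelling_def
  using assms mate_outer rot_outer by (intro conj_cong ball_cong refl) (simp_all del: Un_iff add: Un_upper1[THEN subsetD])

text \<open>\<open>f\<close> retracts each inner side to an emanating side or to a point of
  \<open>P\<close>, which represents circles lying inside the configuration. By
  \<open>inner_f\<close> a side only moves within its own circle, by \<open>inner_S\<close> the
  strands through the configuration join the sides that \<open>r\<close> prescribes, and by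
  \<open>inner_comp\<close> nothing else gets joined.\<close>

lemma num_classes_contract:
  assumes AD: "A \<subseteq> edges \<Gamma>'" "D \<subseteq> edge_of \<Gamma> ` I"
    and P: "P \<subseteq> I \<times> UNIV"
    and f_id: "\<And>p. fst p \<notin> I \<or> p \<in> P \<Longrightarrow> f p = p"
    and f_I: "\<And>p. fst p \<in> I \<Longrightarrow> f p \<in> S \<times> UNIV \<union> P"
    and inner_comp: "\<And>g. \<forall>h\<in>S. g (h, True) = g (r h, False) \<Longrightarrow> inner_labelling D (g \<circ> f)"
    and inner_S: "\<And>g h. inner_labelling D g \<Longrightarrow> h \<in> S \<Longrightarrow> g (h, True) = g (r h, False)"
    and inner_f: "\<And>g p. inner_labelling D g \<Longrightarrow> fst p \<in> I \<Longrightarrow> g (f p) = g p"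
  shows "num_classes (halves \<Gamma> \<times> UNIV) (labelling (add_twists (A \<union> D) \<Gamma>))
    = num_classes (P \<union> halves \<Gamma>' \<times> UNIV) (labelling (add_twists A \<Gamma>'))"
proof (rule num_classes_eqI)
  show "f ` (halves \<Gamma> \<times> UNIV) = P \<union> halves \<Gamma>' \<times> UNIV"
  proof
    show "f ` (halves \<Gamma> \<times> UNIV) \<subseteq> P \<union> halves \<Gamma>' \<times> UNIV"
    proof (rule image_subsetI)
      fix p assume p: "p \<in> halves \<Gamma> \<times> (UNIV :: bool set)"
      show "f p \<in> P \<union> halves \<Gamma>' \<times> UNIV"
        using p f_I[of p] f_id[of p] unfolding halves_eq by (cases "fst p \<in> I") auto
    qed
    show "P \<union> halves \<Gamma>' \<times> UNIV \<subseteq> f ` (halves \<Gamma> \<times> UNIV)"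
    proof
      fix p assume p: "p \<in> P \<union> halves \<Gamma>' \<times> (UNIV :: bool set)"
      then have "p \<in> halves \<Gamma> \<times> UNIV" using P unfolding halves_eq by auto
      moreover have "p = f p"
        using p f_id[of p] disjoint W_halves(2) unfolding halves_eq by fastforce
      ultimately show "p \<in> f ` (halves \<Gamma> \<times> UNIV)" by (rule rev_image_eqI)
    qed
  qed
  have outer_comp: "outer_labelling A (g \<circ> f) \<longleftrightarrow> outer_labelling A g" for g
  proof (rule outer_labelling_cong)
    show "(g \<circ> f) (h, x) = g (h, x)" if "h \<in> outer \<union> S" for h x
      using f_id[of "(h, x)"] not_inner[OF that] by simp
  qed
  show "labelling (add_twists (A \<union> D) \<Gamma>) (g \<circ> f)" if "labelling (add_twists A \<Gamma>') g" for g
    using that inner_comp unfolding labelling_iff[OF AD] labelling_contract_iff outer_comp by blast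
  show "labelling (add_twists A \<Gamma>') (g \<circ> id)" if "labelling (add_twists (A \<union> D) \<Gamma>) g" for g
    using that inner_S unfolding labelling_iff[OF AD] labelling_contract_iff comp_id by blast
  show "g (id (f p)) = g p" if "labelling (add_twists (A \<union> D) \<Gamma>) g" for g and p :: "'h \<times> bool"
    using that inner_f[of g p] f_id[of p] unfolding labelling_iff[OF AD] by (cases "fst p \<in> I") simp_all
qed

lemma circles_contract:
  assumes "A \<subseteq> edges \<Gamma>'" "D \<subseteq> edge_of \<Gamma> ` I"
    and "\<And>p. fst p \<notin> I \<Longrightarrow> f p = p"
    and "\<And>p. fst p \<in> I \<Longrightarrow> fst (f p) \<in> S"
    and "\<And>g. \<forall>h\<in>S. g (h, True) = g (r h, False) \<Longrightarrow> inner_labelling D (g \<circ> f)"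
    and "\<And>g h. inner_labelling D g \<Longrightarrow> h \<in> S \<Longrightarrow> g (h, True) = g (r h, False)"
    and "\<And>g p. inner_labelling D g \<Longrightarrow> fst p \<in> I \<Longrightarrow> g (f p) = g p"
  shows "boundary_circles (add_twists (A \<union> D) \<Gamma>) = boundary_circles (add_twists A \<Gamma>')"
proof -
  have f_I: "f p \<in> S \<times> UNIV \<union> {}" if "fst p \<in> I" for p
    using assms(4)[OF that] by (cases "f p") auto
  have "num_classes (halves \<Gamma> \<times> UNIV) (labelling (add_twists (A \<union> D) \<Gamma>))
    = num_classes ({} \<union> halves \<Gamma>' \<times> UNIV) (labelling (add_twists A \<Gamma>'))"
  proof (rule num_classes_contract[where f = f])
    show "f p = p" if "fst p \<notin> I \<or> p \<in> {}" for p
      using that assms(3) by blast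
  qed (fact assms(1,2,5-7) empty_subsetI f_I)+
  then show ?thesis
    unfolding boundary_circles_eq_num_classes add_twists_simps isolated_contract by simp
qed

text \<open>Here \<open>p\<close> represents a circle inside the configuration. No arc of
  \<open>\<Gamma>'\<close> touches \<open>p\<close>, so its label is free and it adds exactly one
  class.\<close>

lemma circles_contract_Suc:
  assumes "A \<subseteq> edges \<Gamma>'" "D \<subseteq> edge_of \<Gamma> ` I"
    and p: "fst p \<in> I" "f p = p"
    and "\<And>p. fst p \<notin> I \<Longrightarrow> f p = p"
    and "\<And>q. fst q \<in> I \<Longrightarrow> fst (f q) \<in> S \<or> f q = p"
    and "\<And>g. \<forall>h\<in>S. g (h, True) = g (r h, False) \<Longrightarrow> inner_labelling D (g \<circ> f)"
    and "\<And>g h. inner_labelling D g \<Longrightarrow> h \<in> S \<Longrightarrow> g (h, True) = g (r h, False)"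
    and "\<And>g p. inner_labelling D g \<Longrightarrow> fst p \<in> I \<Longrightarrow> g (f p) = g p"
  shows "boundary_circles (add_twists (A \<union> D) \<Gamma>) = Suc (boundary_circles (add_twists A \<Gamma>'))"
proof -
  have f_I: "f q \<in> S \<times> UNIV \<union> {p}" if "fst q \<in> I" for q
    using assms(6)[OF that] by (cases "f q") auto
  have P: "{p} \<subseteq> I \<times> UNIV" using p(1) by (cases p) auto
  have "num_classes (halves \<Gamma> \<times> UNIV) (labelling (add_twists (A \<union> D) \<Gamma>))
    = num_classes ({p} \<union> halves \<Gamma>' \<times> UNIV) (labelling (add_twists A \<Gamma>'))"
  proof (rule num_classes_contract[where f = f])
    show "f q = q" if "fst q \<notin> I \<or> q \<in> {p}" for q
      using that assms(5) p(2) by blast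
  qed (fact assms(1,2,7-9) P f_I)+
  also have "\<dots> = Suc (num_classes (halves \<Gamma>' \<times> UNIV) (labelling (add_twists A \<Gamma>')))"
    unfolding insert_is_Un[symmetric]
  proof (rule num_classes_insert_free)
    show "finite (halves \<Gamma>' \<times> (UNIV :: bool set))"
      using wf_contract by (simp add: wf_rgraph_def del: contract_simps)
    show "p \<notin> halves \<Gamma>' \<times> UNIV"
      using p(1) disjoint W_halves(2) unfolding halves_eq by (cases p) auto
    show "labelling (add_twists A \<Gamma>') (\<lambda>_. True)" by (simp add: labelling_def)
    show "labelling (add_twists A \<Gamma>') (g(p := c))" if g: "labelling (add_twists A \<Gamma>') g" for g c
    proof -
      have upd: "(g(p := c)) (h, x) = g (h, x)" if "h \<in> outer \<union> S" for h x
        using that p(1) disjoint W_halves(2) by (cases p) auto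
      have "outer_labelling A (g(p := c)) \<longleftrightarrow> outer_labelling A g"
        by (rule outer_labelling_cong) (rule upd)
      then show ?thesis using g upd r_S unfolding labelling_contract_iff by simp
    qed
  qed
  finally show ?thesis
    unfolding boundary_circles_eq_num_classes add_twists_simps isolated_contract by simp
qed

text \<open>If the configuration connects the two sides of an emanating ribbon with each other, then
  twisting this ribbon changes nothing, so that such terms cancel in pairs.\<close>

lemma signed_sum_turn_back:
  fixes n :: "'a::comm_ring_1"
  assumes D: "D \<subseteq> edge_of \<Gamma> ` I" and s: "s \<in> S"
    and turn: "\<And>g. inner_labelling D g \<Longrightarrow> g (s, True) = g (s, False)"
  shows "signed_sum (edges \<Gamma>') (\<lambda>A. n ^ boundary_circles (add_twists (A \<union> D) \<Gamma>)) = 0"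
proof (rule signed_sum_toggle_invariant)
  let ?e = "edge_of \<Gamma> s"
  show "finite (edges \<Gamma>')" by (rule finite_edges[OF wf_contract])
  show e: "?e \<in> edges \<Gamma>'" using s unfolding edges_eq by auto
  fix A assume A: "A \<subseteq> edges \<Gamma>'"
  then have A': "toggle ?e A \<subseteq> edges \<Gamma>'" using e by (auto simp: toggle_def)
  \<comment> \<open>If both sides of \<open>s\<close> carry the same label, the ribbon conditions
    say that both sides at the other end carry it too, with or without a half-twist.\<close>
  have "outer_labelling (toggle ?e A) g \<longleftrightarrow> outer_labelling A g" if g: "g (s, True) = g (s, False)" for g
    unfolding outer_labelling_def
  proof (intro conj_cong ball_cong refl)
    fix h assume h: "h \<in> outer \<union> S"
    show "(\<forall>x. g (h, x) = g (mate \<Gamma> h,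
          x = ((edge_of \<Gamma> h \<in> twisted \<Gamma>) \<noteq> (edge_of \<Gamma> h \<in> toggle ?e A)))) \<longleftrightarrow>
        (\<forall>x. g (h, x) = g (mate \<Gamma> h, x = ((edge_of \<Gamma> h \<in> twisted \<Gamma>) \<noteq> (edge_of \<Gamma> h \<in> A))))"
    proof (cases "edge_of \<Gamma> h = ?e")
      case True
      then consider "h = s" | "mate \<Gamma> h = s" by (auto simp: edge_of_def doubleton_eq_iff)
      then show ?thesis
      proof cases
        case 1
        then show ?thesis using g unfolding all_bool_eq by (auto simp: mem_toggle_iff)
      next
        case 2
        then show ?thesis
          using g True unfolding all_bool_eq 2
          by (cases "?e \<in> twisted \<Gamma>"; cases "?e \<in> A") (simp_all add: mem_toggle_iff)
      qed
    next
      case False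
      then show ?thesis by (simp add: mem_toggle_iff)
    qed
  qed
  then have "labelling (add_twists (toggle ?e A \<union> D) \<Gamma>) = labelling (add_twists (A \<union> D) \<Gamma>)"
    unfolding fun_eq_iff labelling_iff[OF A D] labelling_iff[OF A' D] using turn by blast
  then show "n ^ boundary_circles (add_twists (toggle ?e A \<union> D) \<Gamma>)
      = n ^ boundary_circles (add_twists (A \<union> D) \<Gamma>)"
    unfolding boundary_circles_eq_num_classes by simp
qed

section \<open>The contracted vertex\<close>

lemma halves_at_contract: "halves_at \<Gamma>' w = S"
  using w W_halves(1) unfolding halves_at_def by auto

lemma clockwise_at_contract:
  assumes "distinct hs" "set hs = S" "\<And>i. i < length hs \<Longrightarrow> r (hs ! i) = hs ! (Suc i mod length hs)"
  shows "clockwise_at \<Gamma>' w hs"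
  using assms w unfolding clockwise_at_def halves_at_contract by auto

lemma penrose_contract_join:
  assumes S: "S = {s1, s2}" and r: "r s1 = s2" "r s2 = s1"
    and dist: "edge_of \<Gamma> s1 \<noteq> edge_of \<Gamma> s2"
  shows "penrose \<Gamma>' n = 2 * penrose (delete_and_join \<Gamma> W s1 s2) n"
proof -
  have "clockwise_at \<Gamma>' w [s1, s2]"
    using S r dist by (intro clockwise_at_contract) (auto simp: less_Suc_eq)
  then have "penrose \<Gamma>' n = 2 * penrose (delete_and_join \<Gamma>' {w} s1 s2) n"
    using dist by (intro penrose_delete_and_join[OF wf_contract]) simp_all
  \<comment> \<open>Contracting and then deleting \<open>w\<close> agrees with deleting
    \<open>W\<close> at once, except for the values of \<open>vert\<close> and \<open>rot\<close> at
    the deleted half-edges in \<open>S\<close>.\<close>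
  also have "penrose (delete_and_join \<Gamma>' {w} s1 s2) n = penrose (delete_and_join \<Gamma> W s1 s2) n"
  proof -
    have "{h \<in> halves \<Gamma>'. vert \<Gamma>' h \<notin> {w}} = outer"
      using w W_halves(1) unfolding halves_eq(2) by (auto simp: outer_def)
    moreover have "{h \<in> halves \<Gamma>. vert \<Gamma> h \<notin> W} = outer" by (simp add: outer_def)
    moreover have "verts \<Gamma>' - {w} = verts \<Gamma> - W" using w by auto
    moreover have "h \<notin> S" if "h \<in> outer" for h using that disjoint by blast
    ultimately show ?thesis
      by (intro penrose_cong) (simp_all add: delete_and_join_def Let_def r_outer del: contract_simps(1,2))
  qed
  finally show ?thesis .
qed

end

section \<open>Loops, bubbles and triangles\<close>

text \<open>Used to peel off the inner edges one by one, with the twisted ones collected in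
  \<open>D\<close>.\<close>

lemma signed_sum_insert_Un:
  assumes "finite E" "e \<notin> E"
  shows "signed_sum (insert e E) (\<lambda>A. f (A \<union> D))
    = signed_sum E (\<lambda>A. f (A \<union> D)) - signed_sum E (\<lambda>A. f (A \<union> insert e D))"
  using signed_sum_insert[OF assms, of "\<lambda>A. f (A \<union> D)"] by simp

text \<open>The change of side along a ribbon is an involution, so the conditions read from its two
  ends coincide and one per inner edge suffices.\<close>

lemma opposite_edge_condition:
  "(\<forall>x. g (b, x) = g (a, x = t)) \<longleftrightarrow> (\<forall>x. g (a, x) = g (b, x = t))" for g :: "'h \<times> bool \<Rightarrow> bool"
  by (cases t) (auto simp: all_bool_eq)

text \<open>The untwisted loop bounds a face and contributes \<open>n\<close>, the half-twisted one
  contributes -1, and the remaining degree-2 vertex gives the factor 2.\<close>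

lemma penrose_loop:
  assumes wf: "wf_rgraph \<Gamma>"
    and cw: "clockwise_at \<Gamma> v [s1, s2, l, l']"
    and mate: "mate \<Gamma> l = l'" and untw: "edge_of \<Gamma> l \<notin> twisted \<Gamma>"
    and dist: "edge_of \<Gamma> s1 \<noteq> edge_of \<Gamma> s2"
  shows "penrose \<Gamma> n = 2 * (n - 1) * penrose (delete_and_join \<Gamma> {v} s1 s2) n"
proof -
  define c where "c = edge_of \<Gamma> l"
  define r where "r = (rot \<Gamma>)(s1 := s2, s2 := s1)"
  have at: "halves_at \<Gamma> v = {s1, s2, l, l'}" and v: "v \<in> verts \<Gamma>" and neq: "distinct [s1, s2, l, l']"
    using cw by (auto simp: clockwise_at_def)
  have rot: "rot \<Gamma> s1 = s2" "rot \<Gamma> s2 = l" "rot \<Gamma> l = l'" "rot \<Gamma> l' = s1"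
    using cw by (auto simp: clockwise_at_def All_less_Suc)
  have l: "l \<in> halves \<Gamma>" using at by (auto simp: halves_at_def)
  have mate': "mate \<Gamma> l' = l" using wf_mate[OF wf l] mate by simp
  have c: "edge_of \<Gamma> l = c" "edge_of \<Gamma> l' = c" using edge_of_mate[OF wf l] by (simp_all add: c_def mate)
  interpret contraction \<Gamma> "{v}" v "{s1, s2}" "{l, l'}" r
  proof
    show "{h \<in> halves \<Gamma>. vert \<Gamma> h \<in> {v}} = {s1, s2} \<union> {l, l'}"
      using at by (auto simp: halves_at_def)
  qed (use wf v neq at mate mate' untw c in \<open>auto simp: r_def\<close>)
  have inner: "inner_labelling D g \<longleftrightarrow> g (s1, True) = g (s2, False) \<and> g (s2, True) = g (l, False) \<and>
      g (l, True) = g (l', False) \<and> g (l', True) = g (s1, False) \<and> (\<forall>x. g (l, x) = g (l', x = (c \<in> D)))"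
    for D g
    unfolding inner_labelling_def ball_Un ball_simps(5,7) rot mate mate' c
      opposite_edge_condition[of g l'] by (simp only: conj_ac simp_thms)
  \<comment> \<open>The face circle consists of \<open>(l, True)\<close> and
    \<open>(l', False)\<close>; the other two sides of the loop lie on the strand from
    \<open>(s2, True)\<close> to \<open>(s1, False)\<close>.\<close>
  have b0: "boundary_circles (add_twists (A \<union> {}) \<Gamma>) = Suc (boundary_circles (add_twists A \<Gamma>'))"
    if "A \<subseteq> edges \<Gamma>'" for A
  proof (rule circles_contract_Suc[where p = "(l, True)" and f = "(\<lambda>p. p)
      ((l, False) := (s2, True), (l', True) := (s2, True), (l', False) := (l, True))"])
  qed (use that neq in \<open>auto simp: inner all_bool_eq r_def\<close>)
  \<comment> \<open>With the half-twist, all four sides of the loop lie on the strand from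
    \<open>(s2, True)\<close> to \<open>(s1, False)\<close>.\<close>
  have b1: "boundary_circles (add_twists (A \<union> {c}) \<Gamma>) = boundary_circles (add_twists A \<Gamma>')"
    if "A \<subseteq> edges \<Gamma>'" for A
  proof (rule circles_contract[where f = "(\<lambda>p. p)((l, True) := (s2, True),
      (l, False) := (s2, True), (l', True) := (s2, True), (l', False) := (s2, True))"])
  qed (use that neq c in \<open>auto simp: inner all_bool_eq r_def\<close>)
  have E: "edges \<Gamma> = insert c (edges \<Gamma>')" "c \<notin> edges \<Gamma>'"
    using edges_eq(1) edges_disjoint c by auto
  have fin: "finite (edges \<Gamma>')" by (rule finite_edges[OF wf_contract])
  let ?F = "\<lambda>A. n ^ boundary_circles (add_twists A \<Gamma>)"
  have "penrose \<Gamma> n = signed_sum (edges \<Gamma>) (\<lambda>A. ?F (A \<union> {}))"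
    by (simp add: penrose_eq_signed_sum)
  also have "\<dots> = signed_sum (edges \<Gamma>') (\<lambda>A. ?F (A \<union> {})) - signed_sum (edges \<Gamma>') (\<lambda>A. ?F (A \<union> {c}))"
    unfolding E(1) by (rule signed_sum_insert_Un[OF fin E(2)])
  also have "signed_sum (edges \<Gamma>') (\<lambda>A. ?F (A \<union> {})) = n * penrose \<Gamma>' n"
    unfolding penrose_eq_signed_sum signed_sum_mult[symmetric]
    by (rule signed_sum_cong[OF refl]) (simp only: b0 power_Suc)
  also have "signed_sum (edges \<Gamma>') (\<lambda>A. ?F (A \<union> {c})) = penrose \<Gamma>' n"
    unfolding penrose_eq_signed_sum by (rule signed_sum_cong[OF refl]) (simp only: b1)
  also have "penrose \<Gamma>' n = 2 * penrose (delete_and_join \<Gamma> {v} s1 s2) n"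
    using neq by (intro penrose_contract_join refl dist) (simp_all add: r_def)
  finally show ?thesis by (simp add: algebra_simps)
qed

text \<open>Without twists the face circle gives \<open>n\<close>, each single twist gives -1, and
  the doubly twisted term vanishes. The contraction is a degree-2 vertex, which gives the factor
  2.\<close>

lemma penrose_bubble:
  assumes wf: "wf_rgraph \<Gamma>" and v: "v0 \<noteq> v1"
    and cw: "clockwise_at \<Gamma> v0 [s0, a0, b0]" "clockwise_at \<Gamma> v1 [s1, a1, b1]"
    and mate: "mate \<Gamma> a0 = b1" "mate \<Gamma> a1 = b0"
    and untw: "edge_of \<Gamma> a0 \<notin> twisted \<Gamma>" "edge_of \<Gamma> a1 \<notin> twisted \<Gamma>"
    and dist: "edge_of \<Gamma> s0 \<noteq> edge_of \<Gamma> s1"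
  shows "penrose \<Gamma> n = 2 * (n - 2) * penrose (delete_and_join \<Gamma> {v0, v1} s0 s1) n"
proof -
  define c0 c1 where "c0 = edge_of \<Gamma> a0" and "c1 = edge_of \<Gamma> a1"
  define r where "r = (rot \<Gamma>)(s0 := s1, s1 := s0)"
  have at: "halves_at \<Gamma> v0 = {s0, a0, b0}" "halves_at \<Gamma> v1 = {s1, a1, b1}"
    and v': "v0 \<in> verts \<Gamma>" "v1 \<in> verts \<Gamma>"
    using cw by (auto simp: clockwise_at_def)
  have "halves_at \<Gamma> v0 \<inter> halves_at \<Gamma> v1 = {}" using v by (auto simp: halves_at_def)
  \<comment> \<open>The reversed list supplies the inequalities in the opposite direction for the
    simplifier.\<close>
  then have neq: "distinct [s0, a0, b0, s1, a1, b1]" "distinct [b1, a1, s1, b0, a0, s0]"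
    using cw unfolding at by (auto simp: clockwise_at_def)
  have rot: "rot \<Gamma> s0 = a0" "rot \<Gamma> a0 = b0" "rot \<Gamma> b0 = s0"
      "rot \<Gamma> s1 = a1" "rot \<Gamma> a1 = b1" "rot \<Gamma> b1 = s1"
    using cw by (auto simp: clockwise_at_def All_less_Suc)
  have a: "a0 \<in> halves \<Gamma>" "a1 \<in> halves \<Gamma>" using at by (auto simp: halves_at_def)
  have mate': "mate \<Gamma> b1 = a0" "mate \<Gamma> b0 = a1" using wf_mate[OF wf] a mate by metis+
  have c: "edge_of \<Gamma> a0 = c0" "edge_of \<Gamma> b1 = c0" "edge_of \<Gamma> a1 = c1" "edge_of \<Gamma> b0 = c1"
    using edge_of_mate[OF wf a(1)] edge_of_mate[OF wf a(2)] by (simp_all add: c0_def c1_def mate)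
  have c_neq: "c0 \<noteq> c1" using neq by (auto simp: c0_def c1_def edge_of_def mate doubleton_eq_iff)
  interpret contraction \<Gamma> "{v0, v1}" v0 "{s0, s1}" "{a0, b0, a1, b1}" r
  proof
    have "{h \<in> halves \<Gamma>. vert \<Gamma> h \<in> {v0, v1}} = halves_at \<Gamma> v0 \<union> halves_at \<Gamma> v1"
      by (auto simp: halves_at_def)
    then show "{h \<in> halves \<Gamma>. vert \<Gamma> h \<in> {v0, v1}} = {s0, s1} \<union> {a0, b0, a1, b1}"
      unfolding at by auto
  qed (use wf v' neq at mate mate' untw c in \<open>auto simp: r_def\<close>)
  have inner: "inner_labelling D g \<longleftrightarrow>
      g (s0, True) = g (a0, False) \<and> g (a0, True) = g (b0, False) \<and> g (b0, True) = g (s0, False) \<and>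
      g (s1, True) = g (a1, False) \<and> g (a1, True) = g (b1, False) \<and> g (b1, True) = g (s1, False) \<and>
      (\<forall>x. g (a0, x) = g (b1, x = (c0 \<in> D))) \<and> (\<forall>x. g (a1, x) = g (b0, x = (c1 \<in> D)))"
    for D g
    unfolding inner_labelling_def ball_Un ball_simps(5,7) rot mate mate' c
      opposite_edge_condition[of g b0] opposite_edge_condition[of g b1]
    by (simp only: conj_ac simp_thms)
  \<comment> \<open>The face circle runs through \<open>(a0, True)\<close>,
    \<open>(b0, False)\<close>, \<open>(a1, True)\<close> and \<open>(b1, False)\<close>; the first
    of them is kept as its representative.\<close>
  have b: "boundary_circles (add_twists (A \<union> {}) \<Gamma>) = Suc (boundary_circles (add_twists A \<Gamma>'))"
    if "A \<subseteq> edges \<Gamma>'" for A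
  proof (rule circles_contract_Suc[where p = "(a0, True)" and f = "(\<lambda>p. p)
      ((a0, False) := (s0, True), (a1, False) := (s1, True),
       (b0, True) := (s0, False), (b1, True) := (s1, False),
       (b0, False) := (a0, True), (a1, True) := (a0, True), (b1, False) := (a0, True))"])
  qed (use that neq in \<open>auto simp: inner all_bool_eq r_def\<close>)
  \<comment> \<open>The strand from \<open>(s, True)\<close> follows the outer side of
    \<open>c\<close>. Half-twisting \<open>c\<close> merges the face circle into this strand, so the
    face sides are sent to \<open>(s, True)\<close>.\<close>
  have b_twist: "boundary_circles (add_twists (A \<union> {c}) \<Gamma>) = boundary_circles (add_twists A \<Gamma>')"
    if "A \<subseteq> edges \<Gamma>'" "(c, s) \<in> {(c0, s0), (c1, s1)}" for A c s
  proof -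
    let ?f = "(\<lambda>p. p)
      ((a0, False) := (s0, True), (a1, False) := (s1, True),
       (b0, True) := (s0, False), (b1, True) := (s1, False), (a0, True) := (s, True),
       (b0, False) := (s, True), (a1, True) := (s, True), (b1, False) := (s, True))"
    have cs: "c = c0 \<and> s = s0 \<or> c = c1 \<and> s = s1" using that(2) by blast
    have eqs: "g (a0, False) = g (s0, True)" "g (a1, False) = g (s1, True)"
      "g (b0, True) = g (s0, False)" "g (b1, True) = g (s1, False)"
      "g (a0, True) = g (s, True)" "g (b0, False) = g (s, True)"
      "g (a1, True) = g (s, True)" "g (b1, False) = g (s, True)"
      "g (s0, True) = g (s1, False)" "g (s1, True) = g (s0, False)"
      if "inner_labelling {c} g" for g
      using that cs c_neq c_neq[symmetric]
      by (elim disjE conjE; simp only: inner all_bool_eq insert_iff empty_iff simp_thms; argo)+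
    show ?thesis
    proof (rule circles_contract[where f = ?f])
      show "{c} \<subseteq> edge_of \<Gamma> ` {a0, b0, a1, b1}" using cs c by auto
      show "inner_labelling {c} (g \<circ> ?f)" if "\<forall>h\<in>{s0, s1}. g (h, True) = g (r h, False)" for g
        using that cs neq c_neq by (elim disjE conjE) (simp_all add: inner all_bool_eq r_def)
      show "g (h, True) = g (r h, False)" if "inner_labelling {c} g" "h \<in> {s0, s1}" for g h
        using that(2) neq eqs(9,10)[OF that(1)] by (auto simp: r_def)
      show "g (?f p) = g p" if "inner_labelling {c} g" for g p
        unfolding fun_upd_apply using eqs(1-8)[OF that] by (cases p) auto
      show "?f p = p" if "fst p \<notin> {a0, b0, a1, b1}" for p
        unfolding fun_upd_apply using that by (cases p) auto
      have s: "s \<in> {s0, s1}" using cs by blast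
      show "fst (?f p) \<in> {s0, s1}" if "fst p \<in> {a0, b0, a1, b1}" for p
        using s that neq by (cases p; cases "snd p") (simp_all, fastforce+)
    qed (fact that(1))
  qed
  \<comment> \<open>The strand from \<open>(s0, True)\<close> runs through
    \<open>(a0, False)\<close>, \<open>(b1, False)\<close>, \<open>(a1, True)\<close> and
    \<open>(b0, True)\<close> back to \<open>(s0, False)\<close>.\<close>
  have turn: "signed_sum (edges \<Gamma>') (\<lambda>A. n ^ boundary_circles (add_twists (A \<union> {c0, c1}) \<Gamma>)) = 0"
    by (rule signed_sum_turn_back[where s = s0]) (use c in \<open>auto simp: inner all_bool_eq\<close>)
  have E: "edges \<Gamma> = insert c0 (insert c1 (edges \<Gamma>'))" "c0 \<notin> edges \<Gamma>'" "c1 \<notin> edges \<Gamma>'"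
    using edges_eq(1) edges_disjoint c by auto
  have fin: "finite (edges \<Gamma>')" by (rule finite_edges[OF wf_contract])
  let ?F = "\<lambda>A. n ^ boundary_circles (add_twists A \<Gamma>)"
  let ?s = "\<lambda>D. signed_sum (edges \<Gamma>') (\<lambda>A. ?F (A \<union> D))"
  have "penrose \<Gamma> n = signed_sum (edges \<Gamma>) (\<lambda>A. ?F (A \<union> {}))"
    by (simp add: penrose_eq_signed_sum)
  also have "\<dots> = ?s {} - ?s {c1} - (?s {c0} - ?s {c0, c1})"
  proof -
    have "signed_sum (insert e X) (\<lambda>A. ?F (A \<union> D))
        = signed_sum X (\<lambda>A. ?F (A \<union> D)) - signed_sum X (\<lambda>A. ?F (A \<union> insert e D))"
      if "finite X" "e \<notin> X" for e X D
      using that by (rule signed_sum_insert_Un)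
    then show ?thesis
      unfolding E(1) using E(2,3) c_neq fin by (simp only: finite_insert insert_iff insert_commute simp_thms)
  qed
  also have "?s {} = n * penrose \<Gamma>' n"
    unfolding penrose_eq_signed_sum signed_sum_mult[symmetric]
    by (rule signed_sum_cong[OF refl]) (simp only: b power_Suc)
  also have "?s {c0} = penrose \<Gamma>' n"
    unfolding penrose_eq_signed_sum
    by (rule signed_sum_cong[OF refl]) (subst b_twist[of _ c0 s0]; simp)
  also have "?s {c1} = penrose \<Gamma>' n"
    unfolding penrose_eq_signed_sum
    by (rule signed_sum_cong[OF refl]) (subst b_twist[of _ c1 s1]; simp)
  also note turn
  also have "penrose \<Gamma>' n = 2 * penrose (delete_and_join \<Gamma> {v0, v1} s0 s1) n"
    using neq by (intro penrose_contract_join refl dist) (simp_all add: r_def)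
  finally show ?thesis by (simp add: algebra_simps)
qed

text \<open>The eight choices of inner twists contribute \<open>n\<close>, three times -1, three
  times 0 and once +1, in total \<open>n - 2\<close>. The last one is a contraction to the vertex of
  opposite cyclic order, turned back by \<open>penrose_reorder3\<close>.\<close>

lemma penrose_triangle:
  fixes \<Gamma> :: "('v, 'h) rgraph"
  assumes wf: "wf_rgraph \<Gamma>" and v: "distinct [v0, v1, v2]"
    and cw: "clockwise_at \<Gamma> v0 [s0, a0, b0]" "clockwise_at \<Gamma> v1 [s1, a1, b1]"
      "clockwise_at \<Gamma> v2 [s2, a2, b2]"
    and mate: "mate \<Gamma> a0 = b1" "mate \<Gamma> a1 = b2" "mate \<Gamma> a2 = b0"
    and untw: "edge_of \<Gamma> a0 \<notin> twisted \<Gamma>" "edge_of \<Gamma> a1 \<notin> twisted \<Gamma>" "edge_of \<Gamma> a2 \<notin> twisted \<Gamma>"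
    and dist: "distinct [edge_of \<Gamma> s0, edge_of \<Gamma> s1, edge_of \<Gamma> s2]"
  shows "penrose \<Gamma> n = (n - 2) *
    penrose (contract \<Gamma> {v0, v1, v2} v0 {s0, s1, s2} ((rot \<Gamma>)(s0 := s1, s1 := s2, s2 := s0))) n"
proof -
  define c0 c1 c2 where "c0 = edge_of \<Gamma> a0" and "c1 = edge_of \<Gamma> a1" and "c2 = edge_of \<Gamma> a2"
  define r where "r = (rot \<Gamma>)(s0 := s1, s1 := s2, s2 := s0)"
  define r' where "r' = (rot \<Gamma>)(s0 := s2, s2 := s1, s1 := s0)"
  have at: "halves_at \<Gamma> v0 = {s0, a0, b0}" "halves_at \<Gamma> v1 = {s1, a1, b1}"
      "halves_at \<Gamma> v2 = {s2, a2, b2}"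
    and v': "v0 \<in> verts \<Gamma>" "v1 \<in> verts \<Gamma>" "v2 \<in> verts \<Gamma>"
    using cw by (auto simp: clockwise_at_def)
  have "halves_at \<Gamma> v0 \<inter> halves_at \<Gamma> v1 = {}" "halves_at \<Gamma> v0 \<inter> halves_at \<Gamma> v2 = {}"
      "halves_at \<Gamma> v1 \<inter> halves_at \<Gamma> v2 = {}"
    using v by (auto simp: halves_at_def)
  then have neq: "distinct [s0, a0, b0, s1, a1, b1, s2, a2, b2]"
      "distinct [b2, a2, s2, b1, a1, s1, b0, a0, s0]"
    using cw unfolding at by (auto simp: clockwise_at_def)
  have rot: "rot \<Gamma> s0 = a0" "rot \<Gamma> a0 = b0" "rot \<Gamma> b0 = s0"
      "rot \<Gamma> s1 = a1" "rot \<Gamma> a1 = b1" "rot \<Gamma> b1 = s1"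
      "rot \<Gamma> s2 = a2" "rot \<Gamma> a2 = b2" "rot \<Gamma> b2 = s2"
    using cw by (auto simp: clockwise_at_def All_less_Suc)
  have a: "a0 \<in> halves \<Gamma>" "a1 \<in> halves \<Gamma>" "a2 \<in> halves \<Gamma>" using at by (auto simp: halves_at_def)
  have mate': "mate \<Gamma> b1 = a0" "mate \<Gamma> b2 = a1" "mate \<Gamma> b0 = a2"
    using wf_mate[OF wf] a mate by metis+
  have c: "edge_of \<Gamma> a0 = c0" "edge_of \<Gamma> b1 = c0" "edge_of \<Gamma> a1 = c1" "edge_of \<Gamma> b2 = c1"
      "edge_of \<Gamma> a2 = c2" "edge_of \<Gamma> b0 = c2"
    using edge_of_mate[OF wf a(1)] edge_of_mate[OF wf a(2)] edge_of_mate[OF wf a(3)]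
    by (simp_all add: c0_def c1_def c2_def mate)
  have c_neq: "c0 \<noteq> c1" "c0 \<noteq> c2" "c1 \<noteq> c2" "c1 \<noteq> c0" "c2 \<noteq> c0" "c2 \<noteq> c1"
    using neq by (simp_all add: c0_def c1_def c2_def edge_of_def mate doubleton_eq_iff)
  let ?W = "{v0, v1, v2}" and ?S = "{s0, s1, s2}" and ?I = "{a0, b0, a1, b1, a2, b2}"
  have W: "{h \<in> halves \<Gamma>. vert \<Gamma> h \<in> ?W} = ?S \<union> ?I"
  proof -
    have "{h \<in> halves \<Gamma>. vert \<Gamma> h \<in> ?W} = halves_at \<Gamma> v0 \<union> halves_at \<Gamma> v1 \<union> halves_at \<Gamma> v2"
      by (auto simp: halves_at_def)
    then show ?thesis unfolding at by auto
  qed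
  \<comment> \<open>The same configuration is contracted twice: with rotation \<open>r\<close> for
    at most one twisted inner edge, and with the reversed rotation \<open>r'\<close> for
    three.\<close>
  have contr: "contraction \<Gamma> ?W v0 ?S ?I q"
    if "\<And>h. h \<in> ?S \<Longrightarrow> q h \<in> ?S" "\<And>h. h \<notin> ?S \<Longrightarrow> q h = rot \<Gamma> h" for q
  proof
    show "?S \<inter> ?I = {}" using neq by simp
    show "halves_at \<Gamma> u \<noteq> {}" if "u \<in> ?W" for u using that at by blast
    show "mate \<Gamma> h \<in> ?I" if "h \<in> ?I" for h
      using that by (elim insertE emptyE) (simp_all only: mate mate' insert_iff simp_thms)
    show "edge_of \<Gamma> h \<notin> twisted \<Gamma>" if "h \<in> ?I" for h
      using that untw unfolding c by (elim insertE emptyE) (simp_all only: c not_False_eq_True)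
  qed (fact wf W that | use v' in simp)+
  interpret contraction \<Gamma> ?W v0 ?S ?I r
    by (rule contr) (use neq in \<open>auto simp: r_def\<close>)
  interpret rev: contraction \<Gamma> ?W v0 ?S ?I r'
    by (rule contr) (use neq in \<open>auto simp: r'_def\<close>)
  have inner: "inner_labelling D g \<longleftrightarrow>
      g (s0, True) = g (a0, False) \<and> g (a0, True) = g (b0, False) \<and> g (b0, True) = g (s0, False) \<and>
      g (s1, True) = g (a1, False) \<and> g (a1, True) = g (b1, False) \<and> g (b1, True) = g (s1, False) \<and>
      g (s2, True) = g (a2, False) \<and> g (a2, True) = g (b2, False) \<and> g (b2, True) = g (s2, False) \<and>
      (\<forall>x. g (a0, x) = g (b1, x = (c0 \<in> D))) \<and> (\<forall>x. g (a1, x) = g (b2, x = (c1 \<in> D))) \<and>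
      (\<forall>x. g (a2, x) = g (b0, x = (c2 \<in> D)))"
    for D g
    unfolding inner_labelling_def ball_Un ball_simps(5,7) rot mate mate' c
      opposite_edge_condition[of g b0] opposite_edge_condition[of g b1] opposite_edge_condition[of g b2]
    by (simp only: conj_ac simp_thms)
  note inner_eval = inner all_bool_eq insert_iff empty_iff c_neq simp_thms
  \<comment> \<open>The face circle consists of the \<open>True\<close> sides of the
    \<open>a\<close>'s and the \<open>False\<close> sides of the \<open>b\<close>'s, represented by
    \<open>(a0, True)\<close>.\<close>
  have b: "boundary_circles (add_twists (A \<union> {}) \<Gamma>) = Suc (boundary_circles (add_twists A \<Gamma>'))"
    if "A \<subseteq> edges \<Gamma>'" for A
  proof -
    let ?f = "(\<lambda>p. p)
      ((a0, False) := (s0, True), (a1, False) := (s1, True), (a2, False) := (s2, True),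
       (b0, True) := (s0, False), (b1, True) := (s1, False), (b2, True) := (s2, False),
       (b0, False) := (a0, True), (b1, False) := (a0, True), (b2, False) := (a0, True),
       (a1, True) := (a0, True), (a2, True) := (a0, True))"
    have eqs: "g (a0, False) = g (s0, True)" "g (a1, False) = g (s1, True)" "g (a2, False) = g (s2, True)"
      "g (b0, True) = g (s0, False)" "g (b1, True) = g (s1, False)" "g (b2, True) = g (s2, False)"
      "g (b0, False) = g (a0, True)" "g (b1, False) = g (a0, True)" "g (b2, False) = g (a0, True)"
      "g (a1, True) = g (a0, True)" "g (a2, True) = g (a0, True)"
      "g (s0, True) = g (s1, False)" "g (s1, True) = g (s2, False)" "g (s2, True) = g (s0, False)"
      if "inner_labelling {} g" for g
      using that by (simp only: inner_eval; argo)+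
    show ?thesis
    proof (rule circles_contract_Suc[where p = "(a0, True)" and f = ?f])
      show "inner_labelling {} (g \<circ> ?f)" if "\<forall>h\<in>?S. g (h, True) = g (r h, False)" for g
        using that neq by (simp add: inner all_bool_eq r_def)
      show "g (h, True) = g (r h, False)" if "inner_labelling {} g" "h \<in> ?S" for g h
        using that(2) neq eqs(12-14)[OF that(1)] by (auto simp: r_def)
      show "g (?f p) = g p" if "inner_labelling {} g" for g p
        unfolding fun_upd_apply using eqs(1-11)[OF that] by (cases p) auto
      show "?f p = p" if "fst p \<notin> ?I" for p
        unfolding fun_upd_apply using that by (cases p) auto
      show "fst (?f q) \<in> ?S \<or> ?f q = (a0, True)" if "fst q \<in> ?I" for q
        using that neq by (cases q; cases "snd q") (simp_all, fastforce+)
    qed (use neq that in simp_all)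
  qed
  \<comment> \<open>As for the bubble, \<open>s\<close> sits at the starting vertex of
    \<open>c\<close>, and the face circle is absorbed by the strand from \<open>(s, True)\<close>
    along \<open>c\<close>.\<close>
  have b_twist: "boundary_circles (add_twists (A \<union> {c}) \<Gamma>) = boundary_circles (add_twists A \<Gamma>')"
    if "A \<subseteq> edges \<Gamma>'" "(c, s) \<in> {(c0, s0), (c1, s1), (c2, s2)}" for A c s
  proof -
    let ?f = "(\<lambda>p. p)
      ((a0, False) := (s0, True), (a1, False) := (s1, True), (a2, False) := (s2, True),
       (b0, True) := (s0, False), (b1, True) := (s1, False), (b2, True) := (s2, False),
       (b0, False) := (s, True), (b1, False) := (s, True), (b2, False) := (s, True),
       (a0, True) := (s, True), (a1, True) := (s, True), (a2, True) := (s, True))"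
    have cs: "c = c0 \<and> s = s0 \<or> c = c1 \<and> s = s1 \<or> c = c2 \<and> s = s2" using that(2) by blast
    have eqs: "g (a0, False) = g (s0, True)" "g (a1, False) = g (s1, True)" "g (a2, False) = g (s2, True)"
      "g (b0, True) = g (s0, False)" "g (b1, True) = g (s1, False)" "g (b2, True) = g (s2, False)"
      "g (b0, False) = g (s, True)" "g (b1, False) = g (s, True)" "g (b2, False) = g (s, True)"
      "g (a0, True) = g (s, True)" "g (a1, True) = g (s, True)" "g (a2, True) = g (s, True)"
      "g (s0, True) = g (s1, False)" "g (s1, True) = g (s2, False)" "g (s2, True) = g (s0, False)"
      if "inner_labelling {c} g" for g
      using that cs by (elim disjE conjE; simp only: inner_eval; argo)+
    show ?thesis
    proof (rule circles_contract[where f = ?f])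
      show "{c} \<subseteq> edge_of \<Gamma> ` ?I" using cs c by auto
      show "inner_labelling {c} (g \<circ> ?f)" if "\<forall>h\<in>?S. g (h, True) = g (r h, False)" for g
        using that cs neq c_neq by (elim disjE conjE) (simp_all add: inner all_bool_eq r_def)
      show "g (h, True) = g (r h, False)" if "inner_labelling {c} g" "h \<in> ?S" for g h
        using that(2) neq eqs(13-15)[OF that(1)] by (auto simp: r_def)
      show "g (?f p) = g p" if "inner_labelling {c} g" for g p
        unfolding fun_upd_apply using eqs(1-12)[OF that] by (cases p) auto
      show "?f p = p" if "fst p \<notin> ?I" for p
        unfolding fun_upd_apply using that by (cases p) auto
      have s: "s \<in> ?S" using cs by blast
      show "fst (?f p) \<in> ?S" if "fst p \<in> ?I" for p
        using s that neq by (cases p; cases "snd p") (simp_all, fastforce+)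
    qed (fact that(1))
  qed
  \<comment> \<open>With three twists, the strand from \<open>(s0, True)\<close> goes through
    \<open>c0\<close> to the inner side and through \<open>c1\<close> out again to
    \<open>(s2, False)\<close>. So \<open>s2\<close> follows \<open>s0\<close>, and likewise
    cyclically, which is the rotation \<open>r'\<close>.\<close>
  have b_rev: "boundary_circles (add_twists (A \<union> {c0, c1, c2}) \<Gamma>) = boundary_circles (add_twists A rev.\<Gamma>')"
    if "A \<subseteq> edges rev.\<Gamma>'" for A
  proof -
    let ?f = "(\<lambda>p. p)
      ((a0, False) := (s0, True), (b1, False) := (s0, True), (a1, True) := (s0, True), (b2, True) := (s0, True),
       (a1, False) := (s1, True), (b2, False) := (s1, True), (a2, True) := (s1, True), (b0, True) := (s1, True),
       (a2, False) := (s2, True), (b0, False) := (s2, True), (a0, True) := (s2, True), (b1, True) := (s2, True))"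
    have eqs: "g (a0, False) = g (s0, True)" "g (b1, False) = g (s0, True)" "g (a1, True) = g (s0, True)"
      "g (b2, True) = g (s0, True)" "g (a1, False) = g (s1, True)" "g (b2, False) = g (s1, True)"
      "g (a2, True) = g (s1, True)" "g (b0, True) = g (s1, True)" "g (a2, False) = g (s2, True)"
      "g (b0, False) = g (s2, True)" "g (a0, True) = g (s2, True)" "g (b1, True) = g (s2, True)"
      "g (s0, True) = g (s2, False)" "g (s2, True) = g (s1, False)" "g (s1, True) = g (s0, False)"
      if "inner_labelling {c0, c1, c2} g" for g
      using that by (simp only: inner_eval; argo)+
    show ?thesis
    proof (rule rev.circles_contract[where f = ?f])
      show "{c0, c1, c2} \<subseteq> edge_of \<Gamma> ` ?I" using c by auto
      show "inner_labelling {c0, c1, c2} (g \<circ> ?f)" if "\<forall>h\<in>?S. g (h, True) = g (r' h, False)" for g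
        using that neq by (simp add: inner all_bool_eq r'_def)
      show "g (h, True) = g (r' h, False)" if "inner_labelling {c0, c1, c2} g" "h \<in> ?S" for g h
        using that(2) neq eqs(13-15)[OF that(1)] by (auto simp: r'_def)
      show "g (?f p) = g p" if "inner_labelling {c0, c1, c2} g" for g p
        unfolding fun_upd_apply using eqs(1-12)[OF that] by (cases p) auto
      show "?f p = p" if "fst p \<notin> ?I" for p
        unfolding fun_upd_apply using that by (cases p) auto
      show "fst (?f p) \<in> ?S" if "fst p \<in> ?I" for p
        using that neq by (cases p; cases "snd p") (simp_all, fastforce+)
    qed (fact that)
  qed
  let ?F = "\<lambda>A. n ^ boundary_circles (add_twists A \<Gamma>)"
  let ?s = "\<lambda>D. signed_sum (edges \<Gamma>') (\<lambda>A. ?F (A \<union> D))"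
  \<comment> \<open>The witness \<open>s\<close> is the emanating half-edge at the common vertex of
    the two twisted edges: its strand enters the face along one of them, passes the third edge on
    the inside and returns along the other.\<close>
  have turn: "?s {c0, c1} = 0" "?s {c1, c2} = 0" "?s {c0, c2} = 0"
  proof -
    show "?s {c0, c1} = 0"
      by (rule signed_sum_turn_back[where s = s1]; (use c in simp)?) (simp only: inner_eval; argo)
    show "?s {c1, c2} = 0"
      by (rule signed_sum_turn_back[where s = s2]; (use c in simp)?) (simp only: inner_eval; argo)
    show "?s {c0, c2} = 0"
      by (rule signed_sum_turn_back[where s = s0]; (use c in simp)?) (simp only: inner_eval; argo)
  qed
  have E: "edges \<Gamma> = insert c0 (insert c1 (insert c2 (edges \<Gamma>')))"
      "c0 \<notin> edges \<Gamma>'" "c1 \<notin> edges \<Gamma>'" "c2 \<notin> edges \<Gamma>'"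
    using edges_eq(1) edges_disjoint c by auto
  have fin: "finite (edges \<Gamma>')" by (rule finite_edges[OF wf_contract])
  have "penrose \<Gamma> n = signed_sum (edges \<Gamma>) (\<lambda>A. ?F (A \<union> {}))"
    by (simp add: penrose_eq_signed_sum)
  also have "\<dots> = ?s {} - ?s {c2} - (?s {c1} - ?s {c1, c2})
      - (?s {c0} - ?s {c0, c2} - (?s {c0, c1} - ?s {c0, c1, c2}))"
  proof -
    have "signed_sum (insert e X) (\<lambda>A. ?F (A \<union> D))
        = signed_sum X (\<lambda>A. ?F (A \<union> D)) - signed_sum X (\<lambda>A. ?F (A \<union> insert e D))"
      if "finite X" "e \<notin> X" for e X D
      using that by (rule signed_sum_insert_Un)
    then show ?thesis
      unfolding E(1) using E(2-4) c_neq fin by (simp only: finite_insert insert_iff insert_commute simp_thms)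
  qed
  also have "?s {} = n * penrose \<Gamma>' n"
    unfolding penrose_eq_signed_sum signed_sum_mult[symmetric]
    by (rule signed_sum_cong[OF refl]) (simp only: b power_Suc)
  also have "?s {c0} = penrose \<Gamma>' n"
    unfolding penrose_eq_signed_sum
    by (rule signed_sum_cong[OF refl]) (subst b_twist[of _ c0 s0]; simp)
  also have "?s {c1} = penrose \<Gamma>' n"
    unfolding penrose_eq_signed_sum
    by (rule signed_sum_cong[OF refl]) (subst b_twist[of _ c1 s1]; simp)
  also have "?s {c2} = penrose \<Gamma>' n"
    unfolding penrose_eq_signed_sum
    by (rule signed_sum_cong[OF refl]) (subst b_twist[of _ c2 s2]; simp)
  also note turn(1)
  also note turn(2)
  also note turn(3)
  \<comment> \<open>Both contractions have the same edges, so the sums run over the same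
    subsets.\<close>
  also have "?s {c0, c1, c2} = penrose rev.\<Gamma>' n"
    unfolding penrose_eq_signed_sum
    by (rule signed_sum_cong) (simp_all only: edges_eq(2) rev.edges_eq(2) b_rev)
  also have "penrose rev.\<Gamma>' n = - penrose (reorder3 rev.\<Gamma>' s0 s1 s2) n"
  proof (rule penrose_reorder3[OF rev.wf_contract])
    show "clockwise_at rev.\<Gamma>' v0 [s0, s2, s1]"
      using neq by (intro rev.clockwise_at_contract) (auto simp: less_Suc_eq r'_def)
    show "distinct [edge_of rev.\<Gamma>' s0, edge_of rev.\<Gamma>' s1, edge_of rev.\<Gamma>' s2]"
      using dist by simp
  qed
  \<comment> \<open>The two contractions differ only in the rotation at \<open>s0\<close>,
    \<open>s1\<close>, \<open>s2\<close>, which the reordering sets to that of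
    \<open>r\<close>.\<close>
  also have "reorder3 rev.\<Gamma>' s0 s1 s2 = \<Gamma>'"
    using neq by (simp add: reorder3_def contract_def r_def r'_def fun_eq_iff)
  finally show ?thesis unfolding r_def[symmetric] by (simp add: algebra_simps)
qed

section \<open>Assembly of the five replacement rules\<close>

lemma contract_triangle_eq_contract:
  assumes "distinct [v 0, v 1, v 2]"
  shows "contract_triangle \<Gamma> v s = contract \<Gamma> {v 0, v 1, v 2} (v 0) {s 0, s 1, s 2}
    ((rot \<Gamma>)(s 0 := s 1, s 1 := s 2, s 2 := s 0))"
proof -
  have "{v 0, v 1, v 2} - {v 0} = {v 1, v 2}" using assms by auto
  moreover have "(vert \<Gamma>)(s 0 := v 0, s 1 := v 0, s 2 := v 0)
      = (\<lambda>h. if h \<in> {s 0, s 1, s 2} then v 0 else vert \<Gamma> h)"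
    by (auto simp: fun_eq_iff)
  ultimately show ?thesis
    by (simp only: contract_triangle_def contract_def reorder3_def) simp
qed

theorem theorem4p1:
  fixes \<Gamma> :: "('v, 'h) rgraph" and n :: "'a::comm_ring_1"
  assumes "ribbon_graph \<Gamma>"
  shows
    "(\<forall>v s1 s2.
        clockwise_at \<Gamma> v [s1, s2] \<and>
        edge_of \<Gamma> s1 \<noteq> edge_of \<Gamma> s2 \<longrightarrow>
        penrose \<Gamma> n = 2 * penrose (delete_and_join \<Gamma> {v} s1 s2) n) \<and>
     (\<forall>v s1 s2 l l'.
        clockwise_at \<Gamma> v [s1, s2, l, l'] \<and>
        mate \<Gamma> l = l' \<and> edge_of \<Gamma> l \<notin> twisted \<Gamma> \<and>
        edge_of \<Gamma> s1 \<noteq> edge_of \<Gamma> s2 \<longrightarrow>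
        penrose \<Gamma> n = 2 * (n - 1) * penrose (delete_and_join \<Gamma> {v} s1 s2) n) \<and>
     (\<forall>v s a b.
        polygonal_face \<Gamma> 2 v s a b \<and>
        edge_of \<Gamma> (s 0) \<noteq> edge_of \<Gamma> (s 1) \<longrightarrow>
        penrose \<Gamma> n = 2 * (n - 2) * penrose (delete_and_join \<Gamma> {v 0, v 1} (s 0) (s 1)) n) \<and>
     (\<forall>v s1 s2 s3.
        clockwise_at \<Gamma> v [s1, s3, s2] \<and>
        distinct [edge_of \<Gamma> s1, edge_of \<Gamma> s2, edge_of \<Gamma> s3] \<longrightarrow>
        penrose \<Gamma> n = - penrose (reorder3 \<Gamma> s1 s2 s3) n) \<and>
     (\<forall>v s a b.
        polygonal_face \<Gamma> 3 v s a b \<and>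
        distinct [edge_of \<Gamma> (s 0), edge_of \<Gamma> (s 1), edge_of \<Gamma> (s 2)] \<longrightarrow>
        penrose \<Gamma> n = (n - 2) * penrose (contract_triangle \<Gamma> v s) n)"
proof -
  have wf: "wf_rgraph \<Gamma>" by (rule wf_rgraph_of_ribbon_graph[OF assms])
  have bubble: "penrose \<Gamma> n = 2 * (n - 2) * penrose (delete_and_join \<Gamma> {v 0, v 1} (s 0) (s 1)) n"
    if "polygonal_face \<Gamma> 2 v s a b" "edge_of \<Gamma> (s 0) \<noteq> edge_of \<Gamma> (s 1)" for v s a b
  proof (rule penrose_bubble[OF wf, of _ _ _ "a 0" "b 0" _ "a 1" "b 1"])
    have "clockwise_at \<Gamma> (v i) [s i, a i, b i] \<and> mate \<Gamma> (a i) = b (Suc i mod 2) \<and>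
        edge_of \<Gamma> (a i) \<notin> twisted \<Gamma>" if "i < 2" for i
      using that \<open>polygonal_face \<Gamma> 2 v s a b\<close> unfolding polygonal_face_def by blast
    from this[of 0] this[of 1]
    show "clockwise_at \<Gamma> (v 0) [s 0, a 0, b 0]" "clockwise_at \<Gamma> (v 1) [s 1, a 1, b 1]"
      "mate \<Gamma> (a 0) = b 1" "mate \<Gamma> (a 1) = b 0"
      "edge_of \<Gamma> (a 0) \<notin> twisted \<Gamma>" "edge_of \<Gamma> (a 1) \<notin> twisted \<Gamma>"
      by simp_all
    have "inj_on v {..<2}" using that(1) by (simp add: polygonal_face_def)
    then show "v 0 \<noteq> v 1" by (simp add: inj_on_eq_iff)
  qed (fact that(2))
  have triangle: "penrose \<Gamma> n = (n - 2) * penrose (contract_triangle \<Gamma> v s) n"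
    if "polygonal_face \<Gamma> 3 v s a b"
      "distinct [edge_of \<Gamma> (s 0), edge_of \<Gamma> (s 1), edge_of \<Gamma> (s 2)]" for v s a b
  proof -
    have "inj_on v {..<3}" using that(1) by (simp add: polygonal_face_def)
    then have v: "distinct [v 0, v 1, v 2]" by (simp add: inj_on_eq_iff)
    have "clockwise_at \<Gamma> (v i) [s i, a i, b i] \<and> mate \<Gamma> (a i) = b (Suc i mod 3) \<and>
        edge_of \<Gamma> (a i) \<notin> twisted \<Gamma>" if "i < 3" for i
      using that \<open>polygonal_face \<Gamma> 3 v s a b\<close> unfolding polygonal_face_def by blast
    from this[of 0] this[of 1] this[of 2] show ?thesis
      unfolding contract_triangle_eq_contract[of v, OF v]
      by (intro penrose_triangle[OF wf v _ _ _ _ _ _ _ _ _ that(2), of "a 0" "b 0" "a 1" "b 1" "a 2" "b 2"])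
        (simp_all add: numeral_2_eq_2)
  qed
  show ?thesis
    by (intro conjI allI impI; elim conjE;
      rule penrose_delete_and_join[OF wf] penrose_loop[OF wf] penrose_reorder3[OF wf] bubble triangle;
      assumption)
qed

end
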